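(* There is a unique MERW associated with the (unweighted) Young lattice $\mathbb Y$, and it is the Plancherel growth process, i.e. the Markov chain $(\lambda_n)_{n\ge0}$ on $\mathbb Y$ started at the empty diagram whose harmonic function is $\varphi(\lambda)=\frac{d(\varnothing,\lambda)}{n!}$ for $\lambda\vdash n$ (equivalently, $\mathbb P(\lambda_n=\lambda)=\frac{d(\varnothing,\lambda)^2}{n!}$ for $\lambda\vdash n$, with transition probabilities $p(\lambda,\Lambda)=\frac{d(\varnothing,\Lambda)}{(n+1)\,d(\varnothing,\lambda)}$ for $\lambda\vdash n$ and $\lambda\nearrow\Lambda$).
   Context: The Young lattice $\mathbb Y=\bigsqcup_{n\ge0}\mathbb Y_n$ is the graded graph whose $n$-th level $\mathbb Y_n$ is the set of partitions (Young diagrams) $\lambda\vdash n$, with $\mathbb Y_0=\{\varnothing\}$, and with an edge $\lambda\nearrow\Lambda$ iff $\Lambda$ is obtained from $\lambda$ by adding one box. $d(\lambda,\mu)$ is the number of directed paths from $\lambda$ to $\mu$ (so $d(\varnothing,\lambda)$ is the number of standard Young tableaux of shape $\lambda$), and $d(\lambda,\mathbb Y_n)=\sum_{\mu\vdash n}d(\lambda,\mu)$. Definition of MERW: let $\varphi_n(\lambda)=d(\lambda,\mathbb Y_n)/d(\varnothing,\mathbb Y_n)$. If $\varphi^*$ is a pointwise limit of $\varphi_{n_k}$ along some subsequence $n_k\to\infty$, the associated MERW is the Markov chain started at $\varnothing$ with transition probabilities $p(\lambda,\Lambda)=\varphi^*(\Lambda)/\varphi^*(\lambda)$, $\lambda\nearrow\Lambda$,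 on $\{\varphi^*>0\}$. MERWs are the Markov chains arising in this way. *)

theory Defs
  imports "HOL-Probability.Probability"
begin

section \<open>The Young lattice\<close>

text \<open>Partitions are represented by their Young diagrams: finite sets of boxes (row, column),
  indexed from 0, closed under moving up and to the left.\<close>

typedef young =
  "{A :: (nat \<times> nat) set. finite A \<and>
      (\<forall>i j i' j'. (i, j) \<in> A \<longrightarrow> i' \<le> i \<longrightarrow> j' \<le> j \<longrightarrow> (i', j') \<in> A)}"
  morphisms boxes Young
  by (rule exI[of _ "{}"]) simp

definition empty_young :: young where
  "empty_young = Young {}"

definition young_level :: "nat \<Rightarrow> young set" where
  "young_level n = {\<mu>. card (boxes \<mu>) = n}"

definition adds_box :: "young \<Rightarrow> young \<Rightarrow> bool"  (infix "\<nearrow>" 50) where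
  "\<mu> \<nearrow> \<nu> \<longleftrightarrow> (\<exists>b. b \<notin> boxes \<mu> \<and> boxes \<nu> = insert b (boxes \<mu>))"

text \<open>A directed path is given by its nonempty list of vertices; \<^term>\<open>[\<mu>]\<close> is the path of length 0.\<close>

definition young_paths :: "young \<Rightarrow> young \<Rightarrow> young list set" where
  "young_paths \<mu> \<nu> = {xs. xs \<noteq> [] \<and> hd xs = \<mu> \<and> last xs = \<nu> \<and> successively (\<nearrow>) xs}"

definition num_paths :: "young \<Rightarrow> young \<Rightarrow> nat" where
  "num_paths \<mu> \<nu> = card (young_paths \<mu> \<nu>)"

definition num_paths_to_level :: "young \<Rightarrow> nat \<Rightarrow> nat" where
  "num_paths_to_level \<mu> n = (\<Sum>\<nu>\<in>young_level n. num_paths \<mu> \<nu>)"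

text \<open>The cardinalities and sums used here and below range over finite sets.\<close>

lemma boxes_bounded:
  assumes "(i, j) \<in> boxes \<mu>"
  shows "i < card (boxes \<mu>)" "j < card (boxes \<mu>)"
proof -
  have fin: "finite (boxes \<mu>)"
    and down: "\<And>i j i' j'. (i, j) \<in> boxes \<mu> \<Longrightarrow> i' \<le> i \<Longrightarrow> j' \<le> j \<Longrightarrow> (i', j') \<in> boxes \<mu>"
    using boxes[of \<mu>] by auto
  have "(\<lambda>k. (k, j)) ` {..i} \<subseteq> boxes \<mu>" "(\<lambda>k. (i, k)) ` {..j} \<subseteq> boxes \<mu>"
    using assms down by auto
  then have "card ((\<lambda>k. (k, j)) ` {..i}) \<le> card (boxes \<mu>)"
    "card ((\<lambda>k. (i, k)) ` {..j}) \<le> card (boxes \<mu>)"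
    using fin by (auto intro: card_mono)
  then show "i < card (boxes \<mu>)" "j < card (boxes \<mu>)"
    by (simp_all add: card_image inj_on_def)
qed

lemma finite_young_level: "finite (young_level n)"
proof -
  have "boxes ` young_level n \<subseteq> Pow ({..<n} \<times> {..<n})"
    using boxes_bounded by (fastforce simp: young_level_def)
  then have "finite (boxes ` young_level n)"
    by (rule finite_subset) simp
  then show ?thesis
    by (rule finite_imageD) (simp add: inj_on_def boxes_inject)
qed

lemma adds_box_level: "\<mu> \<nearrow> \<nu> \<Longrightarrow> card (boxes \<nu>) = Suc (card (boxes \<mu>))"
  using boxes[of \<mu>] by (auto simp: adds_box_def)

lemma finite_adds_box: "finite {\<nu>. \<mu> \<nearrow> \<nu>}"
  by (rule finite_subset[OF _ finite_young_level[of "Suc (card (boxes \<mu>))"]])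
    (auto simp: young_level_def adds_box_level)

lemma finite_young_paths: "finite (young_paths \<mu> \<nu>)"
proof -
  have le: "length xs + card (boxes (hd xs)) = Suc (card (boxes (last xs))) \<and>
      (\<forall>\<nu>\<in>set xs. card (boxes \<nu>) \<le> card (boxes (last xs)))"
    if "xs \<noteq> []" "successively (\<nearrow>) xs" for xs
    using that
  proof (induction xs rule: list_nonempty_induct)
    case (cons x xs)
    then have "x \<nearrow> hd xs" "successively (\<nearrow>) xs"
      by (auto simp: successively_Cons)
    with cons show ?case
      using adds_box_level[of x "hd xs"] hd_in_set[of xs] by force
  qed simp
  have "young_paths \<mu> \<nu> \<subseteq> {xs. set xs \<subseteq> (\<Union>k\<le>card (boxes \<nu>). young_level k) \<and>
      length xs \<le> Suc (card (boxes \<nu>))}"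
    using le by (fastforce simp: young_paths_def young_level_def)
  then show ?thesis
    by (rule finite_subset) (simp add: finite_lists_length_le finite_young_level)
qed


section \<open>Markov chains\<close>

text \<open>A Markov chain with countable state space is identified with its law on trajectories.
  The transition probabilities \<open>p\<close> are only constrained at states that are visited with positive
  probability.\<close>

definition markov_chain_law ::
    "'a set \<Rightarrow> 'a \<Rightarrow> ('a \<Rightarrow> 'a \<Rightarrow> real) \<Rightarrow> (nat \<Rightarrow> 'a) measure \<Rightarrow> bool" where
  "markov_chain_law S x0 p M \<longleftrightarrow>
     prob_space M \<and>
     sets M = sets (\<Pi>\<^sub>M n\<in>UNIV. count_space UNIV) \<and>
     (AE \<omega> in M. \<omega> 0 = x0) \<and>
     (AE \<omega> in M. \<forall>n. \<omega> n \<in> S) \<and>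
     (\<forall>n s y. \<P>(\<omega> in M. \<forall>i\<le>n. \<omega> i = s i) > 0 \<longrightarrow>
        \<P>(\<omega> in M. \<omega> (Suc n) = y \<bar> \<forall>i\<le>n. \<omega> i = s i) = p (s n) y)"

definition harmonic_young :: "(young \<Rightarrow> real) \<Rightarrow> bool" where
  "harmonic_young \<phi> \<longleftrightarrow>
     (\<forall>\<mu>. \<phi> \<mu> \<ge> 0) \<and> \<phi> empty_young = 1 \<and> (\<forall>\<mu>. \<phi> \<mu> = (\<Sum>\<nu>\<in>{\<nu>. \<mu> \<nearrow> \<nu>}. \<phi> \<nu>))"

definition transition_of :: "(young \<Rightarrow> real) \<Rightarrow> young \<Rightarrow> young \<Rightarrow> real" where
  "transition_of \<phi> \<mu> \<nu> = (if \<mu> \<nearrow> \<nu> then \<phi> \<nu> / \<phi> \<mu> else 0)"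

definition chain_of :: "(young \<Rightarrow> real) \<Rightarrow> (nat \<Rightarrow> young) measure \<Rightarrow> bool" where
  "chain_of \<phi> M \<longleftrightarrow> markov_chain_law {\<mu>. \<phi> \<mu> > 0} empty_young (transition_of \<phi>) M"


section \<open>Maximal entropy random walks\<close>

definition phi_level :: "nat \<Rightarrow> young \<Rightarrow> real" where
  "phi_level n \<mu> = real (num_paths_to_level \<mu> n) / real (num_paths_to_level empty_young n)"

definition merw_function :: "(young \<Rightarrow> real) \<Rightarrow> bool" where
  "merw_function \<phi> \<longleftrightarrow>
     (\<exists>r :: nat \<Rightarrow> nat. strict_mono r \<and> (\<forall>\<mu>. (\<lambda>k. phi_level (r k) \<mu>) \<longlonglongrightarrow> \<phi> \<mu>))"

definition merw :: "(nat \<Rightarrow> young) measure \<Rightarrow> bool" where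
  "merw M \<longleftrightarrow> (\<exists>\<phi>. merw_function \<phi> \<and> chain_of \<phi> M)"


section \<open>The Plancherel growth process\<close>

definition plancherel_function :: "young \<Rightarrow> real" where
  "plancherel_function \<mu> = real (num_paths empty_young \<mu>) / fact (card (boxes \<mu>))"

definition plancherel_growth_process :: "(nat \<Rightarrow> young) measure \<Rightarrow> bool" where
  "plancherel_growth_process M \<longleftrightarrow>
     harmonic_young plancherel_function \<and> chain_of plancherel_function M"

definition plancherel_transition :: "young \<Rightarrow> young \<Rightarrow> real" where
  "plancherel_transition \<mu> \<nu> =
     (if \<mu> \<nearrow> \<nu>
      then real (num_paths empty_young \<nu>) /
           ((real (card (boxes \<mu>)) + 1) * real (num_paths empty_young \<mu>))
      else 0)"

end

theory Submission
  imports Defs "HOL-Real_Asymp.Real_Asymp"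
begin

text \<open>The Young lattice is a differential poset, so the number of upward paths of length \<open>k\<close> from a
  diagram \<open>\<mu>\<close> is \<open>\<Sum>j. (k choose j) * a (k - j) * g j\<close>, where \<open>a n\<close> is the number of involutions of
  \<open>n\<close> points and \<open>g j\<close> counts the downward paths of length \<open>j\<close> from \<open>\<mu>\<close>; in particular
  \<open>d(\<emptyset>, level n) = a n\<close>. Since \<open>a (n + 1) / a n\<close> is asymptotic to \<open>sqrt n\<close>, after division by
  \<open>a (|\<mu>| + k)\<close> only the term \<open>j = |\<mu>|\<close> survives as \<open>k\<close> tends to infinity, with limit
  \<open>g |\<mu>| / |\<mu>|! = d(\<emptyset>, \<mu>) / |\<mu>|!\<close>. Hence the whole sequence of normalized path counts converges to the
  Plancherel function, and the statements about processes follow because the law of a Markov chain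
  is determined by its finite-dimensional cylinder probabilities.\<close>

section \<open>Diagrams as box sets, with unions and intersections\<close>

lemma finite_boxes [simp]: "finite (boxes \<mu>)"
  using boxes[of \<mu>] by auto

lemma boxes_downward: "(i, j) \<in> boxes \<mu> \<Longrightarrow> i' \<le> i \<Longrightarrow> j' \<le> j \<Longrightarrow> (i', j') \<in> boxes \<mu>"
  using boxes[of \<mu>] by auto

lemma boxes_Young:
  assumes "finite A" "\<And>i j i' j'. (i, j) \<in> A \<Longrightarrow> i' \<le> i \<Longrightarrow> j' \<le> j \<Longrightarrow> (i', j') \<in> A"
  shows "boxes (Young A) = A"
  using assms by (intro Young_inverse) blast

lemma boxes_empty_young [simp]: "boxes empty_young = {}"
  unfolding empty_young_def by (rule boxes_Young) auto

lemma boxes_Young_Int [simp]: "boxes (Young (boxes \<mu> \<inter> boxes \<nu>)) = boxes \<mu> \<inter> boxes \<nu>"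
  by (rule boxes_Young) (auto intro: boxes_downward)

lemma boxes_Young_Un [simp]: "boxes (Young (boxes \<mu> \<union> boxes \<nu>)) = boxes \<mu> \<union> boxes \<nu>"
  by (rule boxes_Young) (auto intro: boxes_downward)

lemma young_eqI: "boxes \<mu> = boxes \<nu> \<Longrightarrow> \<mu> = \<nu>"
  by (simp add: boxes_inject)

lemma finite_adds_box_below: "finite {\<kappa>. \<kappa> \<nearrow> \<mu>}"
  by (rule finite_subset[OF _ finite_young_level[of "card (boxes \<mu>) - 1"]])
    (auto simp: young_level_def adds_box_level)

section \<open>The differential poset relation\<close>

text \<open>This recovers the partition from the box set. Adding a box raises a single entry, so
  covers can be counted by row indices.\<close>

definition row_length :: "young \<Rightarrow> nat \<Rightarrow> nat" where
  "row_length \<mu> i = card {j. (i, j) \<in> boxes \<mu>}"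

lemma finite_row: "finite {j. (i, j) \<in> boxes \<mu>}"
  by (rule finite_subset[of _ "snd ` boxes \<mu>"]) force+

lemma boxes_iff_row_length: "(i, j) \<in> boxes \<mu> \<longleftrightarrow> j < row_length \<mu> i"
proof -
  let ?R = "{j. (i, j) \<in> boxes \<mu>}"
  have fin: "finite ?R"
    by (rule finite_row)
  have "?R = {..<card ?R}"
  proof (rule card_subset_eq[symmetric])
    show "finite ?R" by fact
    show "{..<card ?R} \<subseteq> ?R"
    proof (rule ccontr)
      assume "\<not> {..<card ?R} \<subseteq> ?R"
      then obtain k where k: "k < card ?R" "(i, k) \<notin> boxes \<mu>" by auto
      \<comment> \<open>A gap at column \<open>k\<close> excludes all columns to its right, so the
        whole row would fit into \<open>k\<close> places.\<close>
      then have "?R \<subseteq> {..<k}"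
        using boxes_downward by (metis (no_types, lifting) lessThan_iff mem_Collect_eq not_less
            order_refl subsetI)
      then have "card ?R \<le> k"
        using card_mono[of "{..<k}" ?R] by simp
      with k show False by simp
    qed
  qed simp
  then show ?thesis
    by (auto simp: row_length_def)
qed

lemma row_length_antimono: "i \<le> i' \<Longrightarrow> row_length \<mu> i' \<le> row_length \<mu> i"
  by (metis boxes_downward boxes_iff_row_length le_refl not_le)

lemma row_length_inject: "row_length \<mu> = row_length \<nu> \<longleftrightarrow> \<mu> = \<nu>"
proof
  assume "row_length \<mu> = row_length \<nu>"
  then have "boxes \<mu> = boxes \<nu>"
    by (auto simp: boxes_iff_row_length)
  then show "\<mu> = \<nu>" by (rule young_eqI)
qed simp

text \<open>Weakly decreasing, eventually vanishing sequences are the partitions. Neighbours of a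
  diagram are built from their row lengths this way.\<close>

lemma Young_of_row_lengths:
  fixes l :: "nat \<Rightarrow> nat"
  assumes anti: "\<And>i. l (Suc i) \<le> l i" and zero: "\<And>i. i \<ge> N \<Longrightarrow> l i = 0"
  shows "\<exists>\<nu>. row_length \<nu> = l"
proof -
  have antimono: "l i' \<le> l i" if "i \<le> i'" for i i'
    using anti that by (rule lift_Suc_antimono_le)
  let ?A = "{(i, j). j < l i}"
  have "?A \<subseteq> {..<N} \<times> {..<l 0}"
    using zero antimono[of 0] by (auto intro: order_less_le_trans) (metis not_le not_less_zero)
  then have "boxes (Young ?A) = ?A"
    by (intro boxes_Young) (auto intro: finite_subset dest: antimono intro: le_less_trans less_le_trans)
  then have "row_length (Young ?A) = l"
    by (simp add: row_length_def fun_eq_iff)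
  then show ?thesis by blast
qed

lemma row_length_eventually_zero: "i \<ge> card (boxes \<mu>) \<Longrightarrow> row_length \<mu> i = 0"
  using boxes_bounded(1)[of i 0 \<mu>] by (fastforce simp: boxes_iff_row_length)

lemma adds_box_iff_row_length:
  "\<mu> \<nearrow> \<nu> \<longleftrightarrow> (\<exists>i. row_length \<nu> = (row_length \<mu>)(i := Suc (row_length \<mu> i)))"
proof
  assume "\<mu> \<nearrow> \<nu>"
  then obtain i j where ij: "(i, j) \<notin> boxes \<mu>" "boxes \<nu> = insert (i, j) (boxes \<mu>)"
    by (auto simp: adds_box_def)
  have row: "{b. (a, b) \<in> boxes \<nu>} = (if a = i then insert j else id) {b. (a, b) \<in> boxes \<mu>}" for a
    using ij(2) by auto
  have "row_length \<nu> = (row_length \<mu>)(i := Suc (row_length \<mu> i))"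
    using ij(1) by (auto simp: fun_eq_iff row_length_def row finite_row)
  then show "\<exists>i. row_length \<nu> = (row_length \<mu>)(i := Suc (row_length \<mu> i))"
    by blast
next
  assume "\<exists>i. row_length \<nu> = (row_length \<mu>)(i := Suc (row_length \<mu> i))"
  then obtain i where "row_length \<nu> = (row_length \<mu>)(i := Suc (row_length \<mu> i))" ..
  then show "\<mu> \<nearrow> \<nu>"
    unfolding adds_box_def
    by (intro exI[of _ "(i, row_length \<mu> i)"])
      (auto simp: boxes_iff_row_length less_Suc_eq split: if_splits)
qed

section \<open>Addable and removable rows, and the number of covers\<close>

definition addable_rows :: "young \<Rightarrow> nat set" where
  "addable_rows \<mu> = {i. \<exists>\<nu>. row_length \<nu> = (row_length \<mu>)(i := Suc (row_length \<mu> i))}"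

definition removable_rows :: "young \<Rightarrow> nat set" where
  "removable_rows \<mu> = {i. \<exists>\<kappa>. row_length \<mu> = (row_length \<kappa>)(i := Suc (row_length \<kappa> i))}"

lemma addable_rows_eq: "addable_rows \<mu> = {i. i = 0 \<or> row_length \<mu> i < row_length \<mu> (i - 1)}"
proof (intro equalityI subsetI)
  fix i assume "i \<in> addable_rows \<mu>"
  then obtain \<nu> where \<nu>: "row_length \<nu> = (row_length \<mu>)(i := Suc (row_length \<mu> i))"
    by (auto simp: addable_rows_def)
  have "row_length \<nu> i \<le> row_length \<nu> (i - 1)"
    by (intro row_length_antimono) simp
  then show "i \<in> {i. i = 0 \<or> row_length \<mu> i < row_length \<mu> (i - 1)}"
    by (cases i) (auto simp: \<nu>)
next
  fix i assume i: "i \<in> {i. i = 0 \<or> row_length \<mu> i < row_length \<mu> (i - 1)}"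
  have "\<exists>\<nu>. row_length \<nu> = (row_length \<mu>)(i := Suc (row_length \<mu> i))"
  proof (rule Young_of_row_lengths[of _ "Suc i + card (boxes \<mu>)"])
    \<comment> \<open>Raising entry \<open>i\<close> can only break monotonicity at
      \<open>Suc k = i\<close>, where the assumed strict inequality leaves room for one more
      box.\<close>
    fix k show "((row_length \<mu>)(i := Suc (row_length \<mu> i))) (Suc k)
        \<le> ((row_length \<mu>)(i := Suc (row_length \<mu> i))) k"
      using i row_length_antimono[of k "Suc k" \<mu>] by auto
  qed (auto simp: row_length_eventually_zero)
  then show "i \<in> addable_rows \<mu>"
    by (auto simp: addable_rows_def)
qed

lemma removable_rows_eq: "removable_rows \<mu> = {i. row_length \<mu> (Suc i) < row_length \<mu> i}"
proof (intro equalityI subsetI)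
  fix i assume "i \<in> removable_rows \<mu>"
  then obtain \<kappa> where \<kappa>: "row_length \<mu> = (row_length \<kappa>)(i := Suc (row_length \<kappa> i))"
    by (auto simp: removable_rows_def)
  have "row_length \<kappa> (Suc i) \<le> row_length \<kappa> i"
    by (intro row_length_antimono) simp
  then show "i \<in> {i. row_length \<mu> (Suc i) < row_length \<mu> i}"
    by (auto simp: \<kappa>)
next
  fix i assume i: "i \<in> {i. row_length \<mu> (Suc i) < row_length \<mu> i}"
  have "\<exists>\<kappa>. row_length \<kappa> = (row_length \<mu>)(i := row_length \<mu> i - 1)"
  proof (rule Young_of_row_lengths[of _ "Suc i + card (boxes \<mu>)"])
    \<comment> \<open>Lowering entry \<open>i\<close> can only break monotonicity at
      \<open>k = i\<close>, where the inequality is strict by assumption.\<close>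
    fix k show "((row_length \<mu>)(i := row_length \<mu> i - 1)) (Suc k)
        \<le> ((row_length \<mu>)(i := row_length \<mu> i - 1)) k"
      using i row_length_antimono[of k "Suc k" \<mu>] by auto
  qed (auto simp: row_length_eventually_zero)
  then obtain \<kappa> where "row_length \<kappa> = (row_length \<mu>)(i := row_length \<mu> i - 1)" ..
  then have "row_length \<mu> = (row_length \<kappa>)(i := Suc (row_length \<kappa> i))"
    using i by (auto simp: fun_eq_iff)
  then show "i \<in> removable_rows \<mu>"
    by (auto simp: removable_rows_def)
qed

text \<open>A relation that is single-valued in both directions is a bijection from its domain to
  its range. Below, \<open>R\<close> relates a row to the neighbour obtained by changing that
  row.\<close>

lemma card_eq_one_to_one:
  assumes "\<And>x y y'. R x y \<Longrightarrow> R x y' \<Longrightarrow> y = y'" "\<And>x x' y. R x y \<Longrightarrow> R x' y \<Longrightarrow> x = x'"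
  shows "card {x. \<exists>y. R x y} = card {y. \<exists>x. R x y}"
proof -
  define f where "f x = (SOME y. R x y)" for x
  have f: "R x (f x)" if "R x y" for x y
    unfolding f_def using that by (rule someI)
  have "bij_betw f {x. \<exists>y. R x y} {y. \<exists>x. R x y}"
  proof (rule bij_betw_imageI)
    show "inj_on f {x. \<exists>y. R x y}"
    proof (rule inj_onI, clarify)
      fix x x' y y' assume "f x = f x'" "R x y" "R x' y'"
      then show "x = x'" using f[of x y] f[of x' y'] assms(2) by simp
    qed
    show "f ` {x. \<exists>y. R x y} = {y. \<exists>x. R x y}"
      using f assms(1) by blast
  qed
  then show ?thesis
    by (rule bij_betw_same_card)
qed

lemma card_adds_box_above: "card {\<nu>. \<mu> \<nearrow> \<nu>} = card (addable_rows \<mu>)"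
  unfolding adds_box_iff_row_length addable_rows_def
proof (rule card_eq_one_to_one[symmetric])
  fix i i' \<nu>
  assume "row_length \<nu> = (row_length \<mu>)(i := Suc (row_length \<mu> i))"
    and "row_length \<nu> = (row_length \<mu>)(i' := Suc (row_length \<mu> i'))"
  then show "i = i'"
    by (metis fun_upd_other fun_upd_same n_not_Suc_n)
qed (simp add: row_length_inject[symmetric])

lemma card_adds_box_below: "card {\<kappa>. \<kappa> \<nearrow> \<mu>} = card (removable_rows \<mu>)"
  unfolding adds_box_iff_row_length removable_rows_def
proof (rule card_eq_one_to_one[symmetric])
  fix i \<kappa> \<kappa>'
  assume *: "row_length \<mu> = (row_length \<kappa>)(i := Suc (row_length \<kappa> i))"
    "row_length \<mu> = (row_length \<kappa>')(i := Suc (row_length \<kappa>' i))"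
  have "row_length \<kappa> k = row_length \<kappa>' k" for k
    using fun_cong[OF *(1), of k] fun_cong[OF *(2), of k] by (auto split: if_splits)
  then show "\<kappa> = \<kappa>'"
    by (simp add: row_length_inject[symmetric] fun_eq_iff)
next
  fix i i' \<kappa>
  assume "row_length \<mu> = (row_length \<kappa>)(i := Suc (row_length \<kappa> i))"
    and "row_length \<mu> = (row_length \<kappa>)(i' := Suc (row_length \<kappa> i'))"
  then show "i = i'"
    by (metis fun_upd_other fun_upd_same n_not_Suc_n)
qed

lemma finite_removable_rows: "finite (removable_rows \<mu>)"
proof (rule finite_subset)
  show "removable_rows \<mu> \<subseteq> {..<card (boxes \<mu>)}"
    using row_length_eventually_zero by (force simp: removable_rows_eq simp flip: not_less)
qed simp

text \<open>Row \<open>i\<close> is removable exactly when row \<open>Suc i\<close> is addable: both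
  mean that row \<open>i\<close> is strictly longer than the next one. Row 0 is addable in
  addition.\<close>

lemma card_adds_box_above_eq: "card {\<nu>. \<mu> \<nearrow> \<nu>} = Suc (card {\<kappa>. \<kappa> \<nearrow> \<mu>})"
proof -
  have "addable_rows \<mu> = insert 0 (Suc ` removable_rows \<mu>)"
    by (auto simp: addable_rows_eq removable_rows_eq image_iff) (metis Suc_pred neq0_conv diff_Suc_1)
  then show ?thesis
    using finite_removable_rows
    by (simp add: card_adds_box_above card_adds_box_below card_image)
qed

text \<open>The right-hand condition on the two differences is the same as in
  \<open>common_lower_cover_iff\<close>. This is what matches common upper covers with common lower
  covers.\<close>

lemma common_cover_iff:
  assumes "\<kappa> \<noteq> \<mu>"
  shows "\<mu> \<nearrow> \<nu> \<and> \<kappa> \<nearrow> \<nu> \<longleftrightarrow>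
    boxes \<nu> = boxes \<mu> \<union> boxes \<kappa> \<and> (\<exists>a b. boxes \<mu> - boxes \<kappa> = {a} \<and> boxes \<kappa> - boxes \<mu> = {b})"
    (is "?L \<longleftrightarrow> ?R")
proof
  assume ?L
  then obtain a b where "b \<notin> boxes \<mu>" "boxes \<nu> = insert b (boxes \<mu>)"
    "a \<notin> boxes \<kappa>" "boxes \<nu> = insert a (boxes \<kappa>)"
    unfolding adds_box_def by blast
  moreover from this have "a \<noteq> b"
    using assms by (metis insert_ident young_eqI)
  moreover from calculation have "a \<in> boxes \<mu>" "b \<in> boxes \<kappa>"
    by (metis insert_iff)+
  ultimately have "boxes \<nu> = boxes \<mu> \<union> boxes \<kappa> \<and> boxes \<mu> - boxes \<kappa> = {a} \<and> boxes \<kappa> - boxes \<mu> = {b}"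
    unfolding set_eq_iff by simp blast
  then show ?R by blast
next
  assume ?R
  then obtain a b where "boxes \<nu> = boxes \<mu> \<union> boxes \<kappa>" "boxes \<mu> - boxes \<kappa> = {a}" "boxes \<kappa> - boxes \<mu> = {b}"
    by blast
  then have "b \<notin> boxes \<mu>" "boxes \<nu> = insert b (boxes \<mu>)" "a \<notin> boxes \<kappa>" "boxes \<nu> = insert a (boxes \<kappa>)"
    by blast+
  then show ?L
    unfolding adds_box_def by blast
qed

lemma common_lower_cover_iff:
  assumes "\<kappa> \<noteq> \<mu>"
  shows "\<nu> \<nearrow> \<mu> \<and> \<nu> \<nearrow> \<kappa> \<longleftrightarrow>
    boxes \<nu> = boxes \<mu> \<inter> boxes \<kappa> \<and> (\<exists>a b. boxes \<mu> - boxes \<kappa> = {a} \<and> boxes \<kappa> - boxes \<mu> = {b})"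
    (is "?L \<longleftrightarrow> ?R")
proof
  assume ?L
  then obtain a b where "a \<notin> boxes \<nu>" "boxes \<mu> = insert a (boxes \<nu>)"
    "b \<notin> boxes \<nu>" "boxes \<kappa> = insert b (boxes \<nu>)"
    unfolding adds_box_def by blast
  moreover from this have "a \<noteq> b"
    using assms by (metis young_eqI)
  ultimately have "boxes \<nu> = boxes \<mu> \<inter> boxes \<kappa> \<and> boxes \<mu> - boxes \<kappa> = {a} \<and> boxes \<kappa> - boxes \<mu> = {b}"
    unfolding set_eq_iff by simp blast
  then show ?R by blast
next
  assume ?R
  then obtain a b where "boxes \<nu> = boxes \<mu> \<inter> boxes \<kappa>" "boxes \<mu> - boxes \<kappa> = {a}" "boxes \<kappa> - boxes \<mu> = {b}"
    by blast
  then have "a \<notin> boxes \<nu>" "boxes \<mu> = insert a (boxes \<nu>)" "b \<notin> boxes \<nu>" "boxes \<kappa> = insert b (boxes \<nu>)"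
    by blast+
  then show ?L
    unfolding adds_box_def by blast
qed

text \<open>With the up and down operators \<open>U\<close> and \<open>D\<close> of the lattice this is \<open>D U = U D + I\<close>: two
  distinct diagrams have a common upper cover (their union) iff they have a common lower cover
  (their intersection), and every diagram has one more addable than removable box.\<close>

lemma sum_above_below:
  fixes h :: "young \<Rightarrow> 'a::semiring_1"
  shows "(\<Sum>\<nu> | \<mu> \<nearrow> \<nu>. \<Sum>\<kappa> | \<kappa> \<nearrow> \<nu>. h \<kappa>) = h \<mu> + (\<Sum>\<nu> | \<nu> \<nearrow> \<mu>. \<Sum>\<kappa> | \<nu> \<nearrow> \<kappa>. h \<kappa>)"
proof -
  \<comment> \<open>Both double sums are split into the diagonal terms
    \<open>\<kappa> = \<mu>\<close>, which count covers of \<open>\<mu>\<close>, and the pairs with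
    \<open>\<kappa>\<close> different from \<open>\<mu>\<close>.\<close>
  let ?up = "SIGMA \<nu>:{\<nu>. \<mu> \<nearrow> \<nu>}. {\<kappa>. \<kappa> \<nearrow> \<nu>} - {\<mu>}"
  let ?down = "SIGMA \<nu>:{\<nu>. \<nu> \<nearrow> \<mu>}. {\<kappa>. \<nu> \<nearrow> \<kappa>} - {\<mu>}"
  have "(\<Sum>\<nu> | \<mu> \<nearrow> \<nu>. \<Sum>\<kappa> | \<kappa> \<nearrow> \<nu>. h \<kappa>) =
      (\<Sum>\<nu> | \<mu> \<nearrow> \<nu>. h \<mu> + (\<Sum>\<kappa>\<in>{\<kappa>. \<kappa> \<nearrow> \<nu>} - {\<mu>}. h \<kappa>))"
    by (intro sum.cong refl sum.remove finite_adds_box_below) simp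
  also have "\<dots> = of_nat (card {\<nu>. \<mu> \<nearrow> \<nu>}) * h \<mu> + (\<Sum>(\<nu>, \<kappa>)\<in>?up. h \<kappa>)"
    by (subst sum.Sigma[symmetric]) (simp_all add: finite_adds_box finite_adds_box_below sum.distrib)
  \<comment> \<open>For fixed \<open>\<kappa>\<close> the middle diagram is forced: the union on the
    way up, the intersection on the way down.\<close>
  also have "(\<Sum>(\<nu>, \<kappa>)\<in>?up. h \<kappa>) = (\<Sum>(\<nu>, \<kappa>)\<in>?down. h \<kappa>)"
  proof (rule sum.reindex_bij_witness[where
        i = "\<lambda>(\<nu>, \<kappa>). (Young (boxes \<mu> \<union> boxes \<kappa>), \<kappa>)" and
        j = "\<lambda>(\<nu>, \<kappa>). (Young (boxes \<mu> \<inter> boxes \<kappa>), \<kappa>)"], goal_cases)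
    case (1 p)
    then obtain \<nu> \<kappa> where "p = (\<nu>, \<kappa>)" "\<kappa> \<noteq> \<mu>" "\<mu> \<nearrow> \<nu> \<and> \<kappa> \<nearrow> \<nu>"
      by auto
    then show ?case
      by (simp add: common_cover_iff young_eqI)
  next
    case (2 p)
    then obtain \<nu> \<kappa> where "p = (\<nu>, \<kappa>)" "\<kappa> \<noteq> \<mu>" "\<mu> \<nearrow> \<nu> \<and> \<kappa> \<nearrow> \<nu>"
      by auto
    moreover from this have "Young (boxes \<mu> \<inter> boxes \<kappa>) \<nearrow> \<mu> \<and> Young (boxes \<mu> \<inter> boxes \<kappa>) \<nearrow> \<kappa>"
      unfolding common_cover_iff[OF \<open>\<kappa> \<noteq> \<mu>\<close>] common_lower_cover_iff[OF \<open>\<kappa> \<noteq> \<mu>\<close>] by simp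
    ultimately show ?case
      by simp
  next
    case (3 p)
    then obtain \<nu> \<kappa> where "p = (\<nu>, \<kappa>)" "\<kappa> \<noteq> \<mu>" "\<nu> \<nearrow> \<mu> \<and> \<nu> \<nearrow> \<kappa>"
      by auto
    then show ?case
      by (simp add: common_lower_cover_iff young_eqI)
  next
    case (4 p)
    then obtain \<nu> \<kappa> where "p = (\<nu>, \<kappa>)" "\<kappa> \<noteq> \<mu>" "\<nu> \<nearrow> \<mu> \<and> \<nu> \<nearrow> \<kappa>"
      by auto
    moreover from this have "\<mu> \<nearrow> Young (boxes \<mu> \<union> boxes \<kappa>) \<and> \<kappa> \<nearrow> Young (boxes \<mu> \<union> boxes \<kappa>)"
      unfolding common_cover_iff[OF \<open>\<kappa> \<noteq> \<mu>\<close>] common_lower_cover_iff[OF \<open>\<kappa> \<noteq> \<mu>\<close>] by simp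
    ultimately show ?case
      by simp
  qed auto
  also have "of_nat (card {\<nu>. \<mu> \<nearrow> \<nu>}) * h \<mu> + (\<Sum>(\<nu>, \<kappa>)\<in>?down. h \<kappa>) =
      h \<mu> + (of_nat (card {\<nu>. \<nu> \<nearrow> \<mu>}) * h \<mu> + (\<Sum>(\<nu>, \<kappa>)\<in>?down. h \<kappa>))"
    by (simp add: card_adds_box_above_eq algebra_simps)
  also have "of_nat (card {\<nu>. \<nu> \<nearrow> \<mu>}) * h \<mu> + (\<Sum>(\<nu>, \<kappa>)\<in>?down. h \<kappa>) =
      (\<Sum>\<nu> | \<nu> \<nearrow> \<mu>. h \<mu> + (\<Sum>\<kappa>\<in>{\<kappa>. \<nu> \<nearrow> \<kappa>} - {\<mu>}. h \<kappa>))"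
    by (subst sum.Sigma[symmetric]) (simp_all add: finite_adds_box finite_adds_box_below sum.distrib)
  also have "\<dots> = (\<Sum>\<nu> | \<nu> \<nearrow> \<mu>. \<Sum>\<kappa> | \<nu> \<nearrow> \<kappa>. h \<kappa>)"
    by (intro sum.cong refl sum.remove[symmetric] finite_adds_box) simp
  finally show ?thesis .
qed

section \<open>Counting paths\<close>

primrec up_paths :: "nat \<Rightarrow> young \<Rightarrow> nat" where
  "up_paths 0 \<mu> = 1"
| "up_paths (Suc k) \<mu> = (\<Sum>\<nu> | \<mu> \<nearrow> \<nu>. up_paths k \<nu>)"

primrec down_paths :: "nat \<Rightarrow> young \<Rightarrow> nat" where
  "down_paths 0 \<mu> = 1"
| "down_paths (Suc j) \<mu> = (\<Sum>\<kappa> | \<kappa> \<nearrow> \<mu>. down_paths j \<kappa>)"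

text \<open>Every downward step removes a box, so a path cannot be longer than the size of its
  start.\<close>

lemma down_paths_eq_0: "card (boxes \<mu>) < j \<Longrightarrow> down_paths j \<mu> = 0"
proof (induction j arbitrary: \<mu>)
  case (Suc j)
  have "down_paths j \<kappa> = 0" if "\<kappa> \<nearrow> \<mu>" for \<kappa>
    using Suc adds_box_level[OF that] by simp
  then show ?case by simp
qed simp

text \<open>Let \<open>A\<close> and \<open>B\<close> sum a function over the upper and over the
  lower covers. Then \<open>A B = B A + 1\<close>, \<open>A 1 = B 1 + 1\<close> on the constant
  function 1, and \<open>down_paths j\<close> is \<open>B^j 1\<close>. Moving \<open>A\<close> past
  \<open>B^j\<close> yields \<open>j\<close> copies of \<open>B^(j - 1)\<close>. For
  \<open>j = 0\<close> the truncated \<open>j - 1\<close> is harmless because of the factor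
  \<open>j\<close>.\<close>

lemma sum_down_paths_above:
  "(\<Sum>\<nu> | \<mu> \<nearrow> \<nu>. down_paths j \<nu>) = down_paths j \<mu> + down_paths (Suc j) \<mu> + j * down_paths (j - 1) \<mu>"
proof (induction j arbitrary: \<mu>)
  case 0
  then show ?case by (simp add: card_adds_box_above_eq)
next
  case (Suc j)
  have "(\<Sum>\<nu> | \<mu> \<nearrow> \<nu>. down_paths (Suc j) \<nu>) =
      down_paths j \<mu> + (\<Sum>\<nu> | \<nu> \<nearrow> \<mu>. down_paths j \<nu> + down_paths (Suc j) \<nu> + j * down_paths (j - 1) \<nu>)"
    by (simp only: down_paths.simps sum_above_below Suc.IH)
  also have "\<dots> = down_paths (Suc j) \<mu> + down_paths (Suc (Suc j)) \<mu> + (down_paths j \<mu> + j * (\<Sum>\<nu> | \<nu> \<nearrow> \<mu>. down_paths (j - 1) \<nu>))"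
    by (simp add: sum.distrib sum_distrib_left)
  also have "j * (\<Sum>\<nu> | \<nu> \<nearrow> \<mu>. down_paths (j - 1) \<nu>) = j * down_paths j \<mu>"
    by (cases j) auto
  finally show ?case by simp
qed

text \<open>The recursion lets the last of \<open>n + 2\<close> points be fixed or be paired with
  one of the \<open>n + 1\<close> others.\<close>

fun involution_number :: "nat \<Rightarrow> nat" where
  "involution_number 0 = 1"
| "involution_number (Suc 0) = 1"
| "involution_number (Suc (Suc n)) = involution_number (Suc n) + Suc n * involution_number n"

text \<open>For \<open>i < k\<close> this is the recursion of \<open>involution_number\<close> at
  \<open>Suc k - i\<close>, with the factor \<open>k - i\<close> absorbed into the binomial
  coefficient.\<close>

lemma binomial_involution_number:
  "(k choose i) * involution_number (Suc k - i) =
    (k choose i) * involution_number (k - i) + Suc i * (k choose Suc i) * involution_number (k - Suc i)"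
proof (cases "i < k")
  case True
  then obtain b where k: "k = Suc (i + b)"
    using less_imp_Suc_add by blast
  have "Suc i * (k choose Suc i) = Suc b * (k choose i)"
    unfolding k by (rule Suc_times_binomial_add)
  then have "Suc i * (k choose Suc i) * involution_number (k - Suc i) =
      (k choose i) * (Suc b * involution_number b)"
    by (simp add: k del: binomial_Suc_Suc mult_Suc)
  then show ?thesis
    by (simp add: k algebra_simps Suc_diff_le del: binomial_Suc_Suc)
next
  \<comment> \<open>For \<open>i = k\<close> the claim reads \<open>1 = 1 + 0\<close>; for
    \<open>i > k\<close> all the binomial coefficients vanish.\<close>
  case False
  then show ?thesis by (cases "i = k") auto
qed

text \<open>Writing \<open>P\<close> for the sum of all diagrams, \<open>D P = (U + I) P\<close> and \<open>D U - U D = I\<close> give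
  \<open>e^(t D) P = e^(t + t^2/2) e^(t U) P\<close>, whose first factor is the exponential generating function
  of the involution numbers.\<close>

lemma up_paths_eq:
  "up_paths k \<mu> = (\<Sum>j\<le>k. (k choose j) * involution_number (k - j) * down_paths j \<mu>)"
proof (induction k arbitrary: \<mu>)
  case (Suc k)
  define c where "c k j = (k choose j) * involution_number (k - j)" for k j
  have c_zero: "c k (Suc k) = 0"
    by (simp add: c_def)
  \<comment> \<open>Pascal's rule splits off \<open>c k j\<close>;
    \<open>binomial_involution_number\<close> rewrites the remaining part. The three terms match the
    three terms of \<open>sum_down_paths_above\<close>.\<close>
  have c_Suc_Suc: "c (Suc k) (Suc j) = c k (Suc j) + c k j + Suc (Suc j) * c k (Suc (Suc j))" for j
    using binomial_involution_number[of k "Suc j"] by (simp add: c_def algebra_simps)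
  have c_Suc_0: "c (Suc k) 0 = c k 0 + c k (Suc 0)"
    using binomial_involution_number[of k 0] by (simp add: c_def)
  have "up_paths (Suc k) \<mu> = (\<Sum>\<nu> | \<mu> \<nearrow> \<nu>. \<Sum>j\<le>k. c k j * down_paths j \<nu>)"
    by (simp add: Suc.IH c_def)
  also have "\<dots> = (\<Sum>j\<le>k. c k j * (\<Sum>\<nu> | \<mu> \<nearrow> \<nu>. down_paths j \<nu>))"
    unfolding sum_distrib_left by (rule sum.swap)
  also have "\<dots> = (\<Sum>j\<le>k. c k j * down_paths j \<mu>) + (\<Sum>j\<le>k. c k j * down_paths (Suc j) \<mu>)
      + (\<Sum>j\<le>k. j * c k j * down_paths (j - 1) \<mu>)"
    by (simp only: sum_down_paths_above distrib_left sum.distrib mult_ac)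
  also have "(\<Sum>j\<le>k. c k j * down_paths j \<mu>) =
      c k 0 * down_paths 0 \<mu> + (\<Sum>j\<le>k. c k (Suc j) * down_paths (Suc j) \<mu>)"
    using c_zero sum.atMost_Suc_shift[of "\<lambda>j. c k j * down_paths j \<mu>" k] by simp
  also have "(\<Sum>j\<le>k. j * c k j * down_paths (j - 1) \<mu>) =
      c k (Suc 0) * down_paths 0 \<mu> + (\<Sum>j\<le>k. Suc (Suc j) * c k (Suc (Suc j)) * down_paths (Suc j) \<mu>)"
  proof -
    \<comment> \<open>The two added terms vanish with their binomial coefficients. Shifting the
      index twice then drops the zero term \<open>j = 0\<close> and isolates
      \<open>j = 1\<close>.\<close>
    have "(\<Sum>j\<le>k. j * c k j * down_paths (j - 1) \<mu>) = (\<Sum>j\<le>Suc (Suc k). j * c k j * down_paths (j - 1) \<mu>)"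
      by (simp add: c_def)
    then show ?thesis
      by (simp only: sum.atMost_Suc_shift) simp
  qed
  finally show ?case
    unfolding c_def[symmetric] sum.atMost_Suc_shift
    by (simp only: c_Suc_Suc c_Suc_0 distrib_right distrib_left sum.distrib ac_simps)
qed simp

lemma down_paths_empty_young: "down_paths j empty_young = (if j = 0 then 1 else 0)"
  by (simp add: down_paths_eq_0)

lemma up_paths_empty_young: "up_paths k empty_young = involution_number k"
proof -
  have "up_paths k empty_young = (\<Sum>j\<le>k. if j = 0 then involution_number k else 0)"
    unfolding up_paths_eq by (intro sum.cong refl) (simp add: down_paths_empty_young)
  then show ?thesis by simp
qed

section \<open>Paths as vertex lists and their recursions\<close>

lemma length_young_path:
  assumes "xs \<in> young_paths \<mu> \<nu>"
  shows "length xs + card (boxes \<mu>) = Suc (card (boxes \<nu>))"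
proof -
  have "length xs + card (boxes (hd xs)) = Suc (card (boxes (last xs)))"
    if "xs \<noteq> []" "successively (\<nearrow>) xs"
    using that
  proof (induction xs rule: list_nonempty_induct)
    case (cons x xs)
    then show ?case
      using adds_box_level[of x "hd xs"] by (auto simp: successively_Cons)
  qed simp
  with assms show ?thesis by (auto simp: young_paths_def)
qed

lemma num_paths_same_level:
  assumes "card (boxes \<mu>) = card (boxes \<nu>)"
  shows "num_paths \<mu> \<nu> = (if \<mu> = \<nu> then 1 else 0)"
proof -
  have "length xs = 1" if "xs \<in> young_paths \<mu> \<nu>" for xs
    using length_young_path[OF that] assms by simp
  then have "young_paths \<mu> \<nu> \<subseteq> {[x] |x. x = \<mu> \<and> x = \<nu>}"
    by (fastforce simp: young_paths_def length_Suc_conv)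
  moreover have "[\<mu>] \<in> young_paths \<mu> \<mu>"
    by (simp add: young_paths_def)
  ultimately have "young_paths \<mu> \<nu> = (if \<mu> = \<nu> then {[\<mu>]} else {})"
    by auto
  then show ?thesis by (simp add: num_paths_def)
qed

lemma num_paths_first_step:
  assumes "card (boxes \<mu>) < card (boxes \<nu>)"
  shows "num_paths \<mu> \<nu> = (\<Sum>\<kappa> | \<mu> \<nearrow> \<kappa>. num_paths \<kappa> \<nu>)"
proof -
  let ?S = "SIGMA \<kappa>:{\<kappa>. \<mu> \<nearrow> \<kappa>}. young_paths \<kappa> \<nu>"
  have "young_paths \<mu> \<nu> = (\<lambda>(\<kappa>, xs). \<mu> # xs) ` ?S"
  proof (intro equalityI subsetI)
    fix xs assume xs: "xs \<in> young_paths \<mu> \<nu>"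
    then have "length xs > 1"
      using length_young_path[OF xs] assms by linarith
    then obtain x y ys where "xs = x # y # ys"
      by (auto simp: neq_Nil_conv Suc_less_eq2 less_eq_Suc_le Suc_le_length_iff)
    with xs show "xs \<in> (\<lambda>(\<kappa>, xs). \<mu> # xs) ` ?S"
      by (auto simp: young_paths_def image_iff)
  next
    fix xs assume "xs \<in> (\<lambda>(\<kappa>, xs). \<mu> # xs) ` ?S"
    then show "xs \<in> young_paths \<mu> \<nu>"
      by (auto simp: young_paths_def successively_Cons)
  qed
  moreover have "inj_on (\<lambda>(\<kappa>, xs). \<mu> # xs) ?S"
    by (auto simp: inj_on_def young_paths_def)
  ultimately have "num_paths \<mu> \<nu> = card ?S"
    by (simp add: num_paths_def card_image)
  then show ?thesis
    by (simp add: num_paths_def card_SigmaI finite_adds_box finite_young_paths)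
qed

lemma num_paths_last_step:
  assumes "card (boxes \<mu>) < card (boxes \<nu>)"
  shows "num_paths \<mu> \<nu> = (\<Sum>\<kappa> | \<kappa> \<nearrow> \<nu>. num_paths \<mu> \<kappa>)"
proof -
  let ?S = "SIGMA \<kappa>:{\<kappa>. \<kappa> \<nearrow> \<nu>}. young_paths \<mu> \<kappa>"
  have "young_paths \<mu> \<nu> = (\<lambda>(\<kappa>, xs). xs @ [\<nu>]) ` ?S"
  proof (intro equalityI subsetI)
    fix xs assume xs: "xs \<in> young_paths \<mu> \<nu>"
    \<comment> \<open>The strict inequality of sizes rules out the one-vertex path, so a last edge
      exists.\<close>
    then have "length xs > 1"
      using length_young_path[OF xs] assms by linarith
    then obtain ys x where "xs = ys @ [x]" "ys \<noteq> []"
      by (cases xs rule: rev_cases) auto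
    with xs show "xs \<in> (\<lambda>(\<kappa>, xs). xs @ [\<nu>]) ` ?S"
      by (auto simp: young_paths_def image_iff successively_append_iff)
  next
    fix xs assume "xs \<in> (\<lambda>(\<kappa>, xs). xs @ [\<nu>]) ` ?S"
    then show "xs \<in> young_paths \<mu> \<nu>"
      by (auto simp: young_paths_def successively_append_iff)
  qed
  moreover have "inj_on (\<lambda>(\<kappa>, xs). xs @ [\<nu>]) ?S"
    by (auto simp: inj_on_def young_paths_def)
  ultimately have "num_paths \<mu> \<nu> = card ?S"
    by (simp add: num_paths_def card_image)
  then show ?thesis
    by (simp add: num_paths_def card_SigmaI finite_adds_box_below finite_young_paths)
qed

text \<open>The level of the endpoint fixes the length of the path, so splitting off the first step
  reproduces the recursion of \<open>up_paths\<close>.\<close>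

lemma num_paths_to_level_eq: "num_paths_to_level \<mu> (card (boxes \<mu>) + k) = up_paths k \<mu>"
proof (induction k arbitrary: \<mu>)
  case 0
  have "num_paths_to_level \<mu> (card (boxes \<mu>)) =
      (\<Sum>\<nu>\<in>young_level (card (boxes \<mu>)). if \<mu> = \<nu> then 1 else 0)"
    unfolding num_paths_to_level_def
    by (intro sum.cong refl num_paths_same_level) (simp add: young_level_def)
  also have "\<dots> = 1"
    by (simp add: finite_young_level) (simp add: young_level_def)
  finally show ?case by simp
next
  case (Suc k)
  let ?L = "young_level (card (boxes \<mu>) + Suc k)"
  have "num_paths_to_level \<mu> (card (boxes \<mu>) + Suc k) = (\<Sum>\<nu>\<in>?L. \<Sum>\<kappa> | \<mu> \<nearrow> \<kappa>. num_paths \<kappa> \<nu>)"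
    unfolding num_paths_to_level_def
    by (intro sum.cong refl num_paths_first_step) (simp add: young_level_def)
  also have "\<dots> = (\<Sum>\<kappa> | \<mu> \<nearrow> \<kappa>. num_paths_to_level \<kappa> (card (boxes \<mu>) + Suc k))"
    unfolding num_paths_to_level_def by (rule sum.swap)
  also have "\<dots> = (\<Sum>\<kappa> | \<mu> \<nearrow> \<kappa>. up_paths k \<kappa>)"
  proof (intro sum.cong refl)
    fix \<kappa> assume "\<kappa> \<in> {\<kappa>. \<mu> \<nearrow> \<kappa>}"
    then have "card (boxes \<mu>) + Suc k = card (boxes \<kappa>) + k"
      by (simp add: adds_box_level)
    then show "num_paths_to_level \<kappa> (card (boxes \<mu>) + Suc k) = up_paths k \<kappa>"
      by (simp only: Suc.IH)
  qed
  finally show ?case by simp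
qed

lemma num_paths_from_empty_young: "num_paths empty_young \<mu> = down_paths (card (boxes \<mu>)) \<mu>"
proof (induction "card (boxes \<mu>)" arbitrary: \<mu>)
  case 0
  then have "\<mu> = empty_young" by (intro young_eqI) simp
  then show ?case by (simp add: num_paths_same_level)
next
  case (Suc n)
  have "num_paths empty_young \<mu> = (\<Sum>\<kappa> | \<kappa> \<nearrow> \<mu>. num_paths empty_young \<kappa>)"
    using Suc.hyps(2) by (intro num_paths_last_step) simp
  also have "\<dots> = (\<Sum>\<kappa> | \<kappa> \<nearrow> \<mu>. down_paths n \<kappa>)"
    using Suc.hyps adds_box_level by (intro sum.cong refl) fastforce
  finally show ?case by (simp flip: Suc.hyps(2))
qed

text \<open>Without a removable row the row lengths would be weakly increasing as well as eventually
  zero, hence all zero.\<close>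

lemma adds_box_below_exists:
  assumes "\<mu> \<noteq> empty_young"
  shows "\<exists>\<kappa>. \<kappa> \<nearrow> \<mu>"
proof (rule ccontr)
  assume "\<nexists>\<kappa>. \<kappa> \<nearrow> \<mu>"
  then have "removable_rows \<mu> = {}"
    using card_adds_box_below[of \<mu>] finite_removable_rows[of \<mu>] by simp
  have step: "row_length \<mu> i \<le> row_length \<mu> (Suc i)" for i
  proof -
    have "i \<notin> removable_rows \<mu>"
      using \<open>removable_rows \<mu> = {}\<close> by simp
    then show ?thesis by (simp add: removable_rows_eq)
  qed
  have "row_length \<mu> 0 \<le> row_length \<mu> (card (boxes \<mu>))"
    using step by (rule lift_Suc_mono_le) simp
  then have "row_length \<mu> i = 0" for i
    using row_length_antimono[of 0 i \<mu>] by (simp add: row_length_eventually_zero)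
  then have "boxes \<mu> = {}"
    by (auto simp: boxes_iff_row_length)
  with assms show False
    using young_eqI[of \<mu> empty_young] by simp
qed

lemma num_paths_from_empty_young_pos: "num_paths empty_young \<mu> > 0"
proof (induction "card (boxes \<mu>)" arbitrary: \<mu>)
  case 0
  then have "\<mu> = empty_young" by (intro young_eqI) simp
  then show ?case by (simp add: num_paths_same_level)
next
  case (Suc n)
  then have "\<mu> \<noteq> empty_young" by auto
  then obtain \<kappa> where \<kappa>: "\<kappa> \<nearrow> \<mu>" using adds_box_below_exists by blast
  have "0 < num_paths empty_young \<kappa>"
    using Suc.hyps adds_box_level[OF \<kappa>] by simp
  also have "\<dots> \<le> (\<Sum>\<kappa> | \<kappa> \<nearrow> \<mu>. num_paths empty_young \<kappa>)"
    by (rule member_le_sum) (simp_all add: \<kappa> finite_adds_box_below)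
  also have "\<dots> = num_paths empty_young \<mu>"
    using Suc.hyps(2) by (intro num_paths_last_step[symmetric]) simp
  finally show ?case .
qed

section \<open>Asymptotics of path counts\<close>

lemma involution_number_pos: "involution_number n > 0"
  by (induction n rule: involution_number.induct) auto

text \<open>The ratio satisfies \<open>r (n + 1) = 1 + (n + 1) / r n\<close>. This map is decreasing
  in \<open>r n\<close>, so the lower bound yields the next upper bound and the upper bound the next
  lower bound.\<close>

lemma involution_number_ratio_bounds:
  "sqrt (Suc n) \<le> involution_number (Suc n) / involution_number n \<and>
   involution_number (Suc n) / involution_number n \<le> 1 + sqrt (Suc n)"
proof (induction n)
  case (Suc n)
  let ?r = "\<lambda>n. real (involution_number (Suc n)) / involution_number n" and ?s = "sqrt (Suc n)"
  have s: "?s > 0" "?s * ?s = Suc n" "?s \<ge> 1" by simp_all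
  have pos: "?r n > 0" using involution_number_pos by simp
  have r: "?r (Suc n) = 1 + Suc n / ?r n"
    using involution_number_pos[of "Suc n"] by (simp add: field_simps)
  have "?r (Suc n) \<le> 1 + Suc n / ?s"
    unfolding r by (intro add_left_mono divide_left_mono mult_pos_pos pos s conjunct1[OF Suc]) simp
  also have "\<dots> \<le> 1 + sqrt (Suc (Suc n))"
    using s by (simp add: real_div_sqrt)
  finally have upper: "?r (Suc n) \<le> 1 + sqrt (Suc (Suc n))" .
  \<comment> \<open>The square of the right-hand side is at least
    \<open>?s^2 + 2 * ?s / (1 + ?s)\<close>, and the fraction is at least 1 because
    \<open>?s \<ge> 1\<close>.\<close>
  have "sqrt (Suc (Suc n)) \<le> ?s + 1 / (1 + ?s)"
  proof (rule real_le_lsqrt)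
    have "(?s + 1 / (1 + ?s))\<^sup>2 = Suc n + 2 * ?s / (1 + ?s) + (1 / (1 + ?s))\<^sup>2"
      unfolding power2_sum using s by simp
    moreover have "2 * ?s / (1 + ?s) \<ge> 1" using s by (subst le_divide_eq_1_pos) linarith+
    ultimately show "real (Suc (Suc n)) \<le> (?s + 1 / (1 + ?s))\<^sup>2"
      by (smt (verit) of_nat_Suc zero_le_power2)
  qed (use s in auto)
  also have "\<dots> = 1 + Suc n / (1 + ?s)"
  proof -
    have "x + 1 / (1 + x) = 1 + x * x / (1 + x)" if "x > 0" for x :: real
      using that by (simp add: field_simps)
    from this[OF s(1)] show ?thesis by (simp only: s(2))
  qed
  also have "\<dots> \<le> ?r (Suc n)"
    unfolding r
    by (intro add_left_mono divide_left_mono mult_pos_pos add_pos_pos pos s conjunct2[OF Suc]) simp_all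
  finally show ?case using upper by simp
qed simp

text \<open>The quotient is a product of \<open>p\<close> consecutive ratios, each asymptotic to
  \<open>1 / sqrt n\<close> by the preceding bounds.\<close>

lemma involution_number_ratio_tendsto:
  "(\<lambda>n. involution_number n / involution_number (n + p) * sqrt n ^ p) \<longlonglongrightarrow> 1"
proof (induction p)
  case 0
  then show ?case using involution_number_pos by (simp add: less_imp_neq[symmetric])
next
  case (Suc p)
  let ?r = "\<lambda>n. involution_number (n + p) / involution_number (n + Suc p) * sqrt n"
  have "?r \<longlonglongrightarrow> 1"
  proof (rule tendsto_sandwich)
    note bounds = involution_number_ratio_bounds[THEN conjunct1] involution_number_ratio_bounds[THEN conjunct2]
    have pos: "involution_number (Suc (n + p)) / involution_number (n + p) > 0" for n
      using involution_number_pos by simp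
    have r: "?r n = sqrt n / (involution_number (Suc (n + p)) / involution_number (n + p))" for n
      by simp
    show "\<forall>\<^sub>F n in sequentially. sqrt n / (1 + sqrt (Suc (n + p))) \<le> ?r n"
      unfolding r by (intro always_eventually allI divide_left_mono mult_pos_pos bounds pos add_pos_nonneg) simp_all
    show "\<forall>\<^sub>F n in sequentially. ?r n \<le> sqrt n / sqrt (Suc (n + p))"
      unfolding r by (intro always_eventually allI divide_left_mono mult_pos_pos bounds pos) simp_all
    show "(\<lambda>n. sqrt n / (1 + sqrt (Suc (n + p)))) \<longlonglongrightarrow> 1"
      by real_asymp
    show "(\<lambda>n. sqrt n / sqrt (Suc (n + p))) \<longlonglongrightarrow> 1"
      by real_asymp
  qed
  from tendsto_mult[OF Suc this] show ?case
    using involution_number_pos by (simp add: less_imp_neq[symmetric] mult_ac)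
qed

lemma binomial_ratio_tendsto: "(\<lambda>n. ((n + j) choose j) / n ^ j) \<longlonglongrightarrow> 1 / fact j"
proof (induction j)
  case (Suc j)
  have "(\<lambda>n. (n + Suc j) / (n * Suc j)) \<longlonglongrightarrow> 1 / Suc j"
    by (real_asymp simp: divide_simps)
  from tendsto_mult[OF Suc this]
  have "(\<lambda>n. ((n + j) choose j) / n ^ j * ((n + Suc j) / (n * Suc j))) \<longlonglongrightarrow> 1 / fact (Suc j)"
    by (simp add: divide_simps mult.commute[of "fact j"])
  moreover have "((n + j) choose j) / n ^ j * ((n + Suc j) / (n * Suc j)) = ((n + Suc j) choose Suc j) / n ^ Suc j" for n
  proof -
    \<comment> \<open>Nothing is assumed about \<open>x\<close> and \<open>y\<close>, which stand
      for \<open>n ^ j\<close> and \<open>n\<close>, so \<open>n = 0\<close> is covered too.\<close>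
    have cancel: "a / x * (q / (y * r)) = b / (y * x)" if "r * b = q * a" "r \<noteq> 0" for a b q r x y :: real
    proof -
      have "a / x * (q / (y * r)) = (q * a) / (r * (y * x))" by (simp add: mult_ac)
      with that show ?thesis by (simp flip: that(1))
    qed
    have "real (Suc j) * real ((n + Suc j) choose Suc j) = (real n + real (Suc j)) * real ((n + j) choose j)"
      using arg_cong[OF Suc_times_binomial_eq[of "n + j" j], of real]
      by (simp add: algebra_simps del: binomial_Suc_Suc)
    then show ?thesis
      unfolding power_Suc of_nat_add of_nat_mult by (intro cancel) simp_all
  qed
  ultimately show ?case by simp
qed simp

lemma up_paths_coefficient_tendsto:
  assumes "j \<le> m"
  shows "(\<lambda>k. (k choose j) * involution_number (k - j) / involution_number (k + m))
    \<longlonglongrightarrow> (if j = m then 1 / fact m else 0)"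
proof -
  \<comment> \<open>With \<open>k = n + j\<close>, the binomial coefficient grows like
    \<open>n^j / j!\<close> and the involution quotient decays like \<open>n^(-(j + m) / 2)\<close>.
    What remains is \<open>n^(-(m - j) / 2)\<close>, which tends to 0 unless
    \<open>j = m\<close>.\<close>
  let ?f = "\<lambda>n. ((n + j) choose j) / n ^ j *
      (involution_number n / involution_number (n + (j + m)) * sqrt n ^ (j + m)) * (1 / sqrt n ^ (m - j))"
  have "(\<lambda>n. 1 / sqrt (real n) ^ (m - j)) \<longlonglongrightarrow> (if j = m then 1 else 0)"
  proof (cases "j = m")
    case False
    with assms have "m - j > 0" by simp
    then have "(\<lambda>n. 1 / sqrt (real n) ^ (m - j)) \<longlonglongrightarrow> 0" by real_asymp
    with False show ?thesis by simp
  qed simp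
  from tendsto_mult[OF tendsto_mult[OF binomial_ratio_tendsto involution_number_ratio_tendsto] this]
  have "?f \<longlonglongrightarrow> (if j = m then 1 / fact m else 0)"
    by (cases "j = m") simp_all
  moreover have "\<forall>\<^sub>F n in sequentially. ?f n =
      ((n + j) choose j) * involution_number (n + j - j) / involution_number (n + j + m)"
  proof (rule eventually_mono[OF eventually_gt_at_top[of 0]])
    fix n :: nat assume "n > 0"
    have "sqrt n ^ (j + m) = (sqrt n ^ 2) ^ j * sqrt n ^ (m - j)"
      unfolding power_mult[symmetric] power_add[symmetric] using assms by (intro arg_cong2[where f = power]) simp_all
    then have "sqrt n ^ (j + m) = n ^ j * sqrt n ^ (m - j)" by simp
    with \<open>n > 0\<close> show "?f n = ((n + j) choose j) * involution_number (n + j - j) / involution_number (n + j + m)"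
      by (simp add: add.assoc)
  qed
  ultimately have "(\<lambda>n. ((n + j) choose j) * involution_number (n + j - j) / involution_number (n + j + m))
      \<longlonglongrightarrow> (if j = m then 1 / fact m else 0)"
    using tendsto_cong by fast
  then show ?thesis by (rule LIMSEQ_offset)
qed

section \<open>Convergence to the Plancherel function and its harmonicity\<close>

lemma phi_level_tendsto: "(\<lambda>n. phi_level n \<mu>) \<longlonglongrightarrow> plancherel_function \<mu>"
proof -
  let ?m = "card (boxes \<mu>)"
  let ?c = "\<lambda>k j. (k choose j) * involution_number (k - j) / involution_number (k + ?m)"
  have "(\<lambda>k. \<Sum>j\<le>?m. ?c k j * down_paths j \<mu>)
      \<longlonglongrightarrow> (\<Sum>j\<le>?m. (if j = ?m then 1 / fact ?m else 0) * down_paths j \<mu>)"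
    by (intro tendsto_sum tendsto_mult tendsto_const up_paths_coefficient_tendsto) simp
  also have "(\<Sum>j\<le>?m. (if j = ?m then 1 / fact ?m else 0) * real (down_paths j \<mu>)) =
      (\<Sum>j\<le>?m. if j = ?m then plancherel_function \<mu> else 0)"
    by (intro sum.cong refl) (simp add: plancherel_function_def num_paths_from_empty_young)
  also have "\<dots> = plancherel_function \<mu>" by simp
  finally have "(\<lambda>k. \<Sum>j\<le>?m. ?c k j * down_paths j \<mu>) \<longlonglongrightarrow> plancherel_function \<mu>" .
  moreover have "\<forall>\<^sub>F k in sequentially. (\<Sum>j\<le>?m. ?c k j * down_paths j \<mu>) = phi_level (k + ?m) \<mu>"
  \<comment> \<open>Once \<open>k \<ge> ?m\<close>, the sum over \<open>j \<le> k\<close> stops at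
    \<open>?m\<close>, since no downward path is longer. The limit is thus taken in a sum with a
    fixed number of terms.\<close>
  proof (rule eventually_mono[OF eventually_ge_at_top[of ?m]])
    fix k assume k: "k \<ge> ?m"
    have "phi_level (k + ?m) \<mu> = up_paths k \<mu> / involution_number (k + ?m)"
      using num_paths_to_level_eq[of \<mu> k] num_paths_to_level_eq[of empty_young "k + ?m"]
      by (simp add: phi_level_def up_paths_empty_young add.commute)
    also have "\<dots> = (\<Sum>j\<le>k. ?c k j * down_paths j \<mu>)"
      by (simp add: up_paths_eq sum_divide_distrib)
    also have "\<dots> = (\<Sum>j\<le>?m. ?c k j * down_paths j \<mu>)"
      using k by (intro sum.mono_neutral_right) (auto simp: down_paths_eq_0)
    finally show "(\<Sum>j\<le>?m. ?c k j * down_paths j \<mu>) = phi_level (k + ?m) \<mu>" ..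
  qed
  ultimately have "(\<lambda>k. phi_level (k + ?m) \<mu>) \<longlonglongrightarrow> plancherel_function \<mu>"
    using tendsto_cong by fast
  then show ?thesis by (rule LIMSEQ_offset)
qed

text \<open>The full sequence converges, so every subsequence has the same limit.\<close>

lemma merw_function_iff: "merw_function \<phi> \<longleftrightarrow> \<phi> = plancherel_function"
proof
  assume "merw_function \<phi>"
  then obtain r :: "nat \<Rightarrow> nat" where r: "strict_mono r"
    and lim: "\<And>\<mu>. (\<lambda>k. phi_level (r k) \<mu>) \<longlonglongrightarrow> \<phi> \<mu>"
    by (auto simp: merw_function_def)
  show "\<phi> = plancherel_function"
  proof
    fix \<mu>
    have "(\<lambda>k. phi_level (r k) \<mu>) \<longlonglongrightarrow> plancherel_function \<mu>"
      using LIMSEQ_subseq_LIMSEQ[OF phi_level_tendsto r] by (simp add: o_def)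
    with lim show "\<phi> \<mu> = plancherel_function \<mu>" by (rule LIMSEQ_unique)
  qed
next
  assume "\<phi> = plancherel_function"
  then show "merw_function \<phi>"
    unfolding merw_function_def by (intro exI[of _ id]) (simp add: strict_mono_def phi_level_tendsto)
qed

lemma plancherel_function_pos: "plancherel_function \<mu> > 0"
  using num_paths_from_empty_young_pos by (simp add: plancherel_function_def)

text \<open>This is \<open>sum_down_paths_above\<close> with \<open>j\<close> one more than the size
  of \<open>\<mu>\<close>: the first two terms vanish and only the commutator term is left.\<close>

lemma sum_num_paths_from_empty_young_above:
  "(\<Sum>\<nu> | \<mu> \<nearrow> \<nu>. num_paths empty_young \<nu>) = Suc (card (boxes \<mu>)) * num_paths empty_young \<mu>"
proof -
  have "(\<Sum>\<nu> | \<mu> \<nearrow> \<nu>. num_paths empty_young \<nu>) = (\<Sum>\<nu> | \<mu> \<nearrow> \<nu>. down_paths (Suc (card (boxes \<mu>))) \<nu>)"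
    by (intro sum.cong refl) (auto simp: num_paths_from_empty_young adds_box_level simp del: down_paths.simps)
  also have "\<dots> = Suc (card (boxes \<mu>)) * down_paths (card (boxes \<mu>)) \<mu>"
    unfolding sum_down_paths_above by (simp add: down_paths_eq_0 del: down_paths.simps)
  finally show ?thesis by (simp add: num_paths_from_empty_young)
qed

lemma harmonic_plancherel_function: "harmonic_young plancherel_function"
  unfolding harmonic_young_def
proof (intro conjI allI)
  fix \<mu>
  have "(\<Sum>\<nu> | \<mu> \<nearrow> \<nu>. plancherel_function \<nu>) =
      (\<Sum>\<nu> | \<mu> \<nearrow> \<nu>. real (num_paths empty_young \<nu>)) / fact (Suc (card (boxes \<mu>)))"
    unfolding sum_divide_distrib by (intro sum.cong refl) (simp add: plancherel_function_def adds_box_level)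
  also have "\<dots> = plancherel_function \<mu>"
    unfolding of_nat_sum[symmetric] sum_num_paths_from_empty_young_above
    by (simp add: plancherel_function_def divide_simps) (simp add: algebra_simps)
  finally show "plancherel_function \<mu> = (\<Sum>\<nu> | \<mu> \<nearrow> \<nu>. plancherel_function \<nu>)" ..
qed (simp_all add: less_imp_le plancherel_function_pos, simp add: plancherel_function_def num_paths_same_level)

lemma transition_of_plancherel_function: "transition_of plancherel_function = plancherel_transition"
proof (intro ext)
  fix \<mu> \<nu>
  have "a / (b * c) / (d / c) = a / (b * d)" if "c \<noteq> 0" for a b c d :: real
    using that by simp
  from this[of "fact (card (boxes \<mu>))"]
  show "transition_of plancherel_function \<mu> \<nu> = plancherel_transition \<mu> \<nu>"
    by (simp add: transition_of_def plancherel_transition_def plancherel_function_def adds_box_level add.commute)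
qed

section \<open>Markov chains on a countable state space\<close>

abbreviation trajectory_space :: "(nat \<Rightarrow> 'a) measure" where
  "trajectory_space \<equiv> \<Pi>\<^sub>M n\<in>UNIV. count_space UNIV"

definition prefix_prob :: "'a \<Rightarrow> ('a \<Rightarrow> 'a \<Rightarrow> real) \<Rightarrow> (nat \<Rightarrow> 'a) \<Rightarrow> nat \<Rightarrow> real" where
  "prefix_prob x0 p s n = (if s 0 = x0 then \<Prod>i<n. p (s i) (s (Suc i)) else 0)"

lemma space_trajectory_space [simp]: "space trajectory_space = UNIV"
  by (simp add: space_PiM PiE_def extensional_def)

lemma pred_prefix_eq [measurable]:
  "Measurable.pred trajectory_space (\<lambda>\<omega>. \<forall>i\<le>n. \<omega> i = s i)"
  by measurable

text \<open>The chain rule gives the product as long as the prefix has positive probability. Once a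
  prefix is null, all its extensions are null and the product contains a zero factor or starts at
  the wrong state.\<close>

lemma markov_chain_law_prefix_prob:
  assumes "markov_chain_law S x0 p M"
  shows "\<P>(\<omega> in M. \<forall>i\<le>n. \<omega> i = s i) = prefix_prob x0 p s n"
proof -
  interpret prob_space M using assms by (simp add: markov_chain_law_def)
  have sets [measurable_cong]: "sets M = sets trajectory_space"
    using assms by (simp add: markov_chain_law_def)
  have start: "AE \<omega> in M. \<omega> 0 = x0"
    using assms by (simp add: markov_chain_law_def)
  show ?thesis
  proof (induction n)
    case 0
    have "\<P>(\<omega> in M. \<forall>i\<le>0. \<omega> i = s i) = \<P>(\<omega> in M. s 0 = x0)"
      using start by (intro prob_eq_AE) auto
    then show ?case by (simp add: prefix_prob_def prob_space)
  next
    case (Suc n)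
    let ?P = "\<lambda>n. \<P>(\<omega> in M. \<forall>i\<le>n. \<omega> i = s i)"
    have joint: "?P (Suc n) = \<P>(\<omega> in M. \<omega> (Suc n) = s (Suc n) \<and> (\<forall>i\<le>n. \<omega> i = s i))"
      by (rule arg_cong[where f = prob]) (auto simp: le_Suc_eq)
    show ?case
    proof (cases "?P n > 0")
      case True
      then have "p (s n) (s (Suc n)) = \<P>(\<omega> in M. \<omega> (Suc n) = s (Suc n) \<bar> \<forall>i\<le>n. \<omega> i = s i)"
        using assms unfolding markov_chain_law_def by simp
      also have "\<dots> = ?P (Suc n) / ?P n"
        unfolding cond_prob_def joint ..
      finally show ?thesis
        using True Suc by (auto simp: prefix_prob_def field_simps split: if_splits)
    next
      case False
      then have zero: "?P n = 0"
        using measure_nonneg[of M] by (simp add: not_less order_antisym)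
      have "?P (Suc n) \<le> ?P n"
        by (intro finite_measure_mono) auto
      then have "?P (Suc n) = 0"
        using measure_nonneg[of M] zero by (simp add: order_antisym)
      then show ?thesis
        using zero Suc by (auto simp: prefix_prob_def split: if_splits)
    qed
  qed
qed

lemma measurable_prefix [measurable]:
  "(\<lambda>\<omega>. map \<omega> [0..<n]) \<in> trajectory_space \<rightarrow>\<^sub>M count_space (UNIV :: 'a::countable list set)"
proof -
  have "(\<lambda>\<omega>. map \<omega> [0..<n]) -` {xs} \<inter> space trajectory_space \<in> sets trajectory_space" for xs :: "'a list"
  proof -
    have "map \<omega> [0..<n] = xs \<longleftrightarrow> length xs = n \<and> (\<forall>i\<in>{..<n}. \<omega> i = xs ! i)" for \<omega>
      by (auto intro!: nth_equalityI)
    then have "(\<lambda>\<omega>. map \<omega> [0..<n]) -` {xs} \<inter> space trajectory_space =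
        {\<omega> \<in> space trajectory_space. length xs = n \<and> (\<forall>i\<in>{..<n}. \<omega> i = xs ! i)}"
      by auto
    also have "\<dots> \<in> sets trajectory_space"
      by measurable
    finally show ?thesis .
  qed
  then show ?thesis
    by (simp add: measurable_count_space_eq_countable)
qed

text \<open>Prefixes of a given length form a countable set, so their point probabilities determine
  their joint law. These laws determine the measure of every finite-dimensional cylinder.\<close>

lemma trajectory_measure_eqI:
  fixes M N :: "(nat \<Rightarrow> 'a::countable) measure"
  assumes "prob_space M" "prob_space N"
    and sets: "sets M = sets trajectory_space" "sets N = sets trajectory_space"
    and eq: "\<And>n s. \<P>(\<omega> in M. \<forall>i\<le>n. \<omega> i = s i) = \<P>(\<omega> in N. \<forall>i\<le>n. \<omega> i = s i)"
  shows "M = N"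
proof (rule measure_eqI_PiM_infinite[OF sets])
  interpret M: prob_space M by fact
  interpret N: prob_space N by fact
  note [measurable_cong] = sets
  have space [simp]: "space M = UNIV" "space N = UNIV"
    using sets[THEN sets_eq_imp_space_eq] by simp_all
  have distr_eq: "distr M (count_space UNIV) (\<lambda>\<omega>. map \<omega> [0..<Suc n]) = distr N (count_space UNIV) (\<lambda>\<omega>. map \<omega> [0..<Suc n])"
    (is "?M = ?N") for n
  proof (rule measure_eqI_countable[where A = UNIV])
    fix xs :: "'a list"
    have "(\<lambda>\<omega>. map \<omega> [0..<Suc n]) -` {xs} = (if length xs = Suc n then {\<omega>. \<forall>i\<le>n. \<omega> i = xs ! i} else {})"
      by (auto intro!: nth_equalityI simp: less_Suc_eq_le simp del: upt_Suc)
    then show "emeasure ?M {xs} = emeasure ?N {xs}"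
      using eq[of n "(!) xs"]
      by (simp add: emeasure_distr M.emeasure_eq_measure N.emeasure_eq_measure del: upt_Suc)
  qed simp_all
  fix A :: "nat \<Rightarrow> 'a set" and J :: "nat set"
  assume J: "finite J" "\<And>i. i \<in> J \<Longrightarrow> A i \<in> sets (count_space UNIV)"
  obtain n where n: "J \<subseteq> {..n}"
    using J(1) finite_nat_iff_bounded_le by blast
  let ?X = "{xs. length xs = Suc n \<and> (\<forall>i\<in>J. xs ! i \<in> A i)}"
  have "prod_emb UNIV (\<lambda>_. count_space UNIV) J (Pi\<^sub>E J A) = (\<lambda>\<omega>. map \<omega> [0..<Suc n]) -` ?X"
    using n by (auto simp: prod_emb_def PiE_iff extensional_def less_Suc_eq_le subset_iff simp del: upt_Suc)
  moreover have "emeasure M ((\<lambda>\<omega>. map \<omega> [0..<Suc n]) -` ?X) = emeasure N ((\<lambda>\<omega>. map \<omega> [0..<Suc n]) -` ?X)"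
    using arg_cong[OF distr_eq[of n], of "\<lambda>M. emeasure M ?X"] by (simp add: emeasure_distr del: upt_Suc)
  ultimately show "emeasure M (prod_emb UNIV (\<lambda>_. count_space UNIV) J (Pi\<^sub>E J A)) =
      emeasure N (prod_emb UNIV (\<lambda>_. count_space UNIV) J (Pi\<^sub>E J A))"
    by simp
next
  show "finite_measure M" using assms(1) by (rule prob_space.finite_measure)
qed

lemma markov_chain_law_unique:
  fixes M N :: "(nat \<Rightarrow> 'a::countable) measure"
  assumes "markov_chain_law S x0 p M" "markov_chain_law S' x0 p N"
  shows "M = N"
proof (rule trajectory_measure_eqI)
  show "\<P>(\<omega> in M. \<forall>i\<le>n. \<omega> i = s i) = \<P>(\<omega> in N. \<forall>i\<le>n. \<omega> i = s i)" for n s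
    by (simp only: markov_chain_law_prefix_prob[OF assms(1)] markov_chain_law_prefix_prob[OF assms(2)])
qed (use assms in \<open>simp_all add: markov_chain_law_def\<close>)

lemma markov_chain_lawI_prefix_prob:
  assumes "prob_space M" and sets: "sets M = sets trajectory_space"
    and prefix: "\<And>n s. \<P>(\<omega> in M. \<forall>i\<le>n. \<omega> i = s i) = prefix_prob x0 p s n"
  shows "markov_chain_law UNIV x0 p M"
proof -
  interpret prob_space M by fact
  note [measurable_cong] = sets
  have "\<P>(\<omega> in M. \<omega> 0 = x0) = 1"
    using prefix[of 0 "\<lambda>_. x0"] by (simp add: prefix_prob_def)
  then have start: "AE \<omega> in M. \<omega> 0 = x0"
    by (subst (asm) prob_Collect_eq_1) auto
  have "\<P>(\<omega> in M. \<omega> (Suc n) = y \<bar> \<forall>i\<le>n. \<omega> i = s i) = p (s n) y"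
    if pos: "\<P>(\<omega> in M. \<forall>i\<le>n. \<omega> i = s i) > 0" for n s y
  proof -
    \<comment> \<open>Overwriting \<open>s\<close> at \<open>Suc n\<close> turns the joint event
      into a longer prefix event.\<close>
    have "\<P>(\<omega> in M. \<omega> (Suc n) = y \<and> (\<forall>i\<le>n. \<omega> i = s i)) = \<P>(\<omega> in M. \<forall>i\<le>Suc n. \<omega> i = (s(Suc n := y)) i)"
      by (rule arg_cong[where f = prob]) (auto simp: le_Suc_eq)
    also have "\<dots> = prefix_prob x0 p s n * p (s n) y"
      by (auto simp: prefix prefix_prob_def)
    finally show ?thesis
      using pos unfolding cond_prob_def by (simp add: prefix)
  qed
  then show ?thesis
    using start \<open>prob_space M\<close> sets by (simp add: markov_chain_law_def)
qed

text \<open>The random map \<open>f\<close> has an independent coordinate for every pair of a time and a state, so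
  prescribing a trajectory constrains distinct coordinates even if states are revisited.\<close>

primrec chain_path :: "'a \<Rightarrow> (nat \<times> 'a \<Rightarrow> 'a) \<Rightarrow> nat \<Rightarrow> 'a" where
  "chain_path x0 f 0 = x0"
| "chain_path x0 f (Suc n) = f (n, chain_path x0 f n)"

lemma chain_path_eq_iff:
  "(\<forall>i\<le>n. chain_path x0 f i = s i) \<longleftrightarrow> s 0 = x0 \<and> (\<forall>i<n. f (i, s i) = s (Suc i))"
  by (induction n) (auto simp: le_Suc_eq less_Suc_eq)

lemma markov_chain_exists:
  fixes K :: "'a::countable \<Rightarrow> 'a pmf"
  shows "\<exists>M. markov_chain_law UNIV x0 (\<lambda>x. pmf (K x)) M"
proof -
  let ?\<Omega> = "\<Pi>\<^sub>M z\<in>(UNIV :: (nat \<times> 'a) set). measure_pmf (K (snd z))"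
  interpret product_prob_space "\<lambda>z :: nat \<times> 'a. measure_pmf (K (snd z))" UNIV
    by (intro product_prob_spaceI prob_space_measure_pmf)
  have coord [measurable]: "(\<lambda>f. f z) \<in> ?\<Omega> \<rightarrow>\<^sub>M count_space UNIV" for z
    using measurable_component_singleton[of z UNIV "\<lambda>z. measure_pmf (K (snd z))"] by simp
  have path [measurable]: "(\<lambda>f. chain_path x0 f n) \<in> ?\<Omega> \<rightarrow>\<^sub>M count_space UNIV" for n
  proof (induction n)
    case (Suc n)
    have "(\<lambda>f. f (n, chain_path x0 f n)) \<in> ?\<Omega> \<rightarrow>\<^sub>M count_space UNIV"
      \<comment> \<open>The coordinate that is read is itself random, but takes only countably many
        values.\<close>
      by (rule measurable_compose_countable[OF coord Suc])
    then show ?case by simp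
  qed simp
  have meas [measurable]: "chain_path x0 \<in> ?\<Omega> \<rightarrow>\<^sub>M trajectory_space"
    by (rule measurable_PiM_single') auto
  let ?M = "distr ?\<Omega> trajectory_space (chain_path x0)"
  have "markov_chain_law UNIV x0 (\<lambda>x. pmf (K x)) ?M"
  proof (rule markov_chain_lawI_prefix_prob)
    show "prob_space ?M" by (intro P.prob_space_distr meas)
    show "sets ?M = sets trajectory_space" by simp
    fix n and s :: "nat \<Rightarrow> 'a"
    let ?J = "(\<lambda>i. (i, s i)) ` {..<n}"
    have "\<P>(\<omega> in ?M. \<forall>i\<le>n. \<omega> i = s i) = \<P>(f in ?\<Omega>. \<forall>i\<le>n. chain_path x0 f i = s i)"
      using pred_prefix_eq[of n s]
      by (subst measure_distr) (auto simp: pred_def intro!: arg_cong[where f = "measure ?\<Omega>"])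
    also have "\<dots> = (if s 0 = x0 then \<P>(f in ?\<Omega>. \<forall>i<n. f (i, s i) = s (Suc i)) else 0)"
      unfolding chain_path_eq_iff by simp
    \<comment> \<open>The time component makes \<open>(i, s i)\<close> injective in
      \<open>i\<close>, so each coordinate is constrained once and independence gives the
      product.\<close>
    also have "{f \<in> space ?\<Omega>. \<forall>i<n. f (i, s i) = s (Suc i)} = emb UNIV ?J (Pi\<^sub>E ?J (\<lambda>z. {s (Suc (fst z))}))"
      by (auto simp: prod_emb_def space_PiM PiE_iff)
    also have "P.prob \<dots> = (\<Prod>i<n. pmf (K (s i)) (s (Suc i)))"
      by (subst measure_PiM_emb) (auto simp: prod.reindex inj_on_def measure_pmf_single)
    finally show "\<P>(\<omega> in ?M. \<forall>i\<le>n. \<omega> i = s i) = prefix_prob x0 (\<lambda>x. pmf (K x)) s n"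
      by (simp add: prefix_prob_def)
  qed
  then show ?thesis ..
qed

text \<open>Each prefix of probability zero gives a null set. Encoding prefixes as lists makes the
  union of these sets countable.\<close>

lemma AE_prefix_prob_nonzero:
  fixes M :: "(nat \<Rightarrow> 'a::countable) measure"
  assumes "markov_chain_law S x0 p M"
  shows "AE \<omega> in M. prefix_prob x0 p \<omega> n \<noteq> 0"
proof -
  interpret prob_space M using assms by (simp add: markov_chain_law_def)
  have sets [measurable_cong]: "sets M = sets trajectory_space"
    using assms by (simp add: markov_chain_law_def)
  have "AE \<omega> in M. prefix_prob x0 p ((!) xs) n = 0 \<longrightarrow> \<not> (\<forall>i\<le>n. \<omega> i = xs ! i)" for xs
  proof (cases "prefix_prob x0 p ((!) xs) n = 0")
    case True
    then have "\<P>(\<omega> in M. \<forall>i\<le>n. \<omega> i = xs ! i) = 0"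
      by (simp add: markov_chain_law_prefix_prob[OF assms])
    then show ?thesis
      by (subst (asm) prob_Collect_eq_0) auto
  qed simp
  then have "AE \<omega> in M. \<forall>xs. prefix_prob x0 p ((!) xs) n = 0 \<longrightarrow> \<not> (\<forall>i\<le>n. \<omega> i = xs ! i)"
    by (simp add: AE_all_countable)
  then show ?thesis
  proof (rule AE_mp, intro AE_I2 impI notI)
    fix \<omega>
    assume *: "\<forall>xs. prefix_prob x0 p ((!) xs) n = 0 \<longrightarrow> \<not> (\<forall>i\<le>n. \<omega> i = xs ! i)"
      and zero: "prefix_prob x0 p \<omega> n = 0"
    let ?xs = "map \<omega> [0..<Suc n]"
    have nth: "?xs ! i = \<omega> i" if "i \<le> n" for i
      using that by (simp del: upt_Suc)
    have "prefix_prob x0 p ((!) ?xs) n = prefix_prob x0 p \<omega> n"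
      unfolding prefix_prob_def by (simp add: nth del: upt_Suc)
    with * zero nth show False by metis
  qed
qed

section \<open>The Plancherel growth process\<close>

instance young :: countable
proof
  have "countable (\<Union>n. young_level n)"
    by (simp add: countable_finite finite_young_level)
  also have "(\<Union>n. young_level n) = UNIV"
    by (auto simp: young_level_def)
  finally show "\<exists>to_nat :: young \<Rightarrow> nat. inj to_nat"
    by (auto simp: countable_def)
qed

text \<open>The quotients telescope along a path, so all paths to the same diagram are equally
  likely.\<close>

lemma prefix_prob_transition_of:
  fixes \<phi> :: "young \<Rightarrow> real"
  assumes "harmonic_young \<phi>" "s 0 = empty_young" "\<And>i. i < n \<Longrightarrow> s i \<nearrow> s (Suc i)"
  shows "prefix_prob empty_young (transition_of \<phi>) s n = \<phi> (s n)"
proof -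
  have nonneg: "\<phi> \<mu> \<ge> 0" and empty: "\<phi> empty_young = 1" and harm: "\<phi> \<mu> = (\<Sum>\<nu> | \<mu> \<nearrow> \<nu>. \<phi> \<nu>)" for \<mu>
    using assms(1) unfolding harmonic_young_def by blast+
  show ?thesis
    using assms(3)
  proof (induction n)
    case 0
    then show ?case using empty by (simp add: prefix_prob_def assms(2))
  next
    case (Suc n)
    have step: "s n \<nearrow> s (Suc n)" using Suc.prems by simp
    have "\<phi> (s (Suc n)) \<le> (\<Sum>\<nu> | s n \<nearrow> \<nu>. \<phi> \<nu>)"
      using step nonneg by (intro member_le_sum finite_adds_box) auto
    also have "\<dots> = \<phi> (s n)"
      by (rule harm[symmetric])
    \<comment> \<open>This covers a zero denominator: the quotient is then 0 by convention, and so
      is the value that telescoping requires.\<close>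
    finally have "\<phi> (s n) = 0 \<Longrightarrow> \<phi> (s (Suc n)) = 0"
      using nonneg by (simp add: order_antisym)
    moreover have "prefix_prob empty_young (transition_of \<phi>) s (Suc n) = \<phi> (s n) * (\<phi> (s (Suc n)) / \<phi> (s n))"
      using Suc step by (simp add: prefix_prob_def assms(2) transition_of_def)
    ultimately show ?case by auto
  qed
qed

lemma young_paths_map_iff:
  "map \<omega> [0..<Suc n] \<in> young_paths \<mu> \<nu> \<longleftrightarrow> \<omega> 0 = \<mu> \<and> \<omega> n = \<nu> \<and> (\<forall>i<n. \<omega> i \<nearrow> \<omega> (Suc i))"
proof -
  have "hd (map \<omega> [0..<Suc n]) = \<omega> 0" by (simp add: hd_map del: upt_Suc)
  moreover have "last (map \<omega> [0..<Suc n]) = \<omega> n" by simp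
  moreover have "successively (\<nearrow>) (map \<omega> [0..<Suc n]) \<longleftrightarrow> (\<forall>i<n. \<omega> i \<nearrow> \<omega> (Suc i))"
    by (auto simp: successively_conv_nth simp del: upt_Suc)
  ultimately show ?thesis
    unfolding young_paths_def by (simp del: upt_Suc)
qed

text \<open>Almost surely the trajectory follows edges, so the event splits into one prefix event
  per path from the empty diagram to \<open>\<mu>\<close>, each of probability
  \<open>\<phi> \<mu>\<close>.\<close>

lemma chain_of_marginal:
  fixes \<phi> :: "young \<Rightarrow> real"
  assumes "harmonic_young \<phi>" "chain_of \<phi> M" "\<mu> \<in> young_level n"
  shows "\<P>(\<omega> in M. \<omega> n = \<mu>) = num_paths empty_young \<mu> * \<phi> \<mu>"
proof -
  have law: "markov_chain_law {\<mu>. \<phi> \<mu> > 0} empty_young (transition_of \<phi>) M"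
    using assms(2) by (simp add: chain_of_def)
  interpret prob_space M using law by (simp add: markov_chain_law_def)
  have sets [measurable_cong]: "sets M = sets trajectory_space"
    using law by (simp add: markov_chain_law_def)
  let ?E = "\<lambda>xs. {\<omega> \<in> space M. \<forall>i\<le>n. \<omega> i = xs ! i}"
  let ?P = "young_paths empty_young \<mu>"
  have len: "length xs = Suc n" if "xs \<in> ?P" for xs
    using length_young_path[OF that] assms(3) by (simp add: young_level_def)
  have path_nth: "xs ! 0 = empty_young \<and> xs ! n = \<mu> \<and> (\<forall>i<n. xs ! i \<nearrow> xs ! Suc i)"
    if "xs \<in> ?P" for xs
    using that len[OF that] young_paths_map_iff[of "(!) xs" n empty_young \<mu>] map_nth[of xs] by simp
  have "\<P>(\<omega> in M. \<omega> n = \<mu>) = prob (\<Union>xs\<in>?P. ?E xs)"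
  proof (rule finite_measure_eq_AE)
    show "AE \<omega> in M. \<omega> \<in> {\<omega> \<in> space M. \<omega> n = \<mu>} \<longleftrightarrow> \<omega> \<in> (\<Union>xs\<in>?P. ?E xs)"
      using AE_prefix_prob_nonzero[OF law, of n] AE_space
    proof eventually_elim
      case (elim \<omega>)
      let ?xs = "map \<omega> [0..<Suc n]"
      have "\<omega> 0 = empty_young" "\<forall>i<n. \<omega> i \<nearrow> \<omega> (Suc i)"
        using elim(1) by (auto simp: prefix_prob_def transition_of_def split: if_splits)
      then have "?xs \<in> ?P" if "\<omega> n = \<mu>"
        using that by (simp only: young_paths_map_iff)
      moreover have "\<omega> \<in> ?E ?xs"
        using elim(2) by (simp del: upt_Suc)
      ultimately have "\<omega> \<in> (\<Union>xs\<in>?P. ?E xs)" if "\<omega> n = \<mu>"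
        using that by blast
      moreover have "\<omega> n = \<mu>" if "xs \<in> ?P" "\<omega> \<in> ?E xs" for xs
        using that path_nth[of xs] by simp
      ultimately show ?case
        using elim(2) by blast
    qed
  qed (auto intro!: sets.finite_UN finite_young_paths)
  also have "\<dots> = (\<Sum>xs\<in>?P. prob (?E xs))"
  proof (rule finite_measure_finite_Union)
    show "disjoint_family_on ?E ?P"
      unfolding disjoint_family_on_def
    proof (intro ballI impI equals0I)
      fix xs ys \<omega> assume "xs \<in> ?P" "ys \<in> ?P" "xs \<noteq> ys" "\<omega> \<in> ?E xs \<inter> ?E ys"
      then show False
        using len[of xs] len[of ys] nth_equalityI[of xs ys] by (auto simp: less_Suc_eq_le)
    qed
  qed (auto intro: finite_young_paths)
  also have "\<dots> = (\<Sum>xs\<in>?P. \<phi> \<mu>)"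
  proof (rule sum.cong)
    fix xs assume "xs \<in> ?P"
    then have "prefix_prob empty_young (transition_of \<phi>) ((!) xs) n = \<phi> \<mu>"
      using path_nth[of xs] prefix_prob_transition_of[OF assms(1), of "(!) xs" n] by simp
    then show "prob (?E xs) = \<phi> \<mu>"
      by (simp add: markov_chain_law_prefix_prob[OF law])
  qed simp
  finally show ?thesis by (simp add: num_paths_def)
qed

section \<open>Existence, uniqueness and characterizations of the process\<close>

lemma plancherel_growth_process_iff_chain_of:
  "plancherel_growth_process M \<longleftrightarrow> chain_of plancherel_function M"
  by (simp add: plancherel_growth_process_def harmonic_plancherel_function)

lemma plancherel_growth_process_iff_markov_chain_law:
  "plancherel_growth_process M \<longleftrightarrow> markov_chain_law UNIV empty_young plancherel_transition M"
  by (simp add: plancherel_growth_process_iff_chain_of chain_of_def plancherel_function_pos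
      transition_of_plancherel_function)

lemma plancherel_growth_process_unique:
  "plancherel_growth_process M \<Longrightarrow> plancherel_growth_process N \<Longrightarrow> M = N"
  unfolding plancherel_growth_process_iff_markov_chain_law by (rule markov_chain_law_unique)

lemma plancherel_growth_process_exists: "\<exists>M. plancherel_growth_process M"
proof -
  have nonneg: "plancherel_transition \<mu> \<nu> \<ge> 0" for \<mu> \<nu>
    by (simp add: plancherel_transition_def)
  have harm: "plancherel_function \<mu> = (\<Sum>\<nu> | \<mu> \<nearrow> \<nu>. plancherel_function \<nu>)" for \<mu>
    using harmonic_plancherel_function unfolding harmonic_young_def by blast
  have sum_1: "(\<Sum>\<nu> | \<mu> \<nearrow> \<nu>. plancherel_transition \<mu> \<nu>) = 1" for \<mu>
  \<comment> \<open>Harmonicity together with positivity of the Plancherel function makes each row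
    of transitions sum to 1, as \<open>embed_pmf\<close> requires.\<close>
  proof -
    have "(\<Sum>\<nu> | \<mu> \<nearrow> \<nu>. plancherel_transition \<mu> \<nu>) =
        (\<Sum>\<nu> | \<mu> \<nearrow> \<nu>. plancherel_function \<nu>) / plancherel_function \<mu>"
      unfolding sum_divide_distrib transition_of_plancherel_function[symmetric]
      by (intro sum.cong refl) (simp add: transition_of_def)
    also have "(\<Sum>\<nu> | \<mu> \<nearrow> \<nu>. plancherel_function \<nu>) = plancherel_function \<mu>"
      by (rule harm[symmetric])
    also have "plancherel_function \<mu> / plancherel_function \<mu> = 1"
      using plancherel_function_pos[of \<mu>] by simp
    finally show ?thesis .
  qed
  have "(\<integral>\<^sup>+\<nu>. plancherel_transition \<mu> \<nu> \<partial>count_space UNIV) = 1" for \<mu>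
  proof -
    have "(\<integral>\<^sup>+\<nu>. plancherel_transition \<mu> \<nu> \<partial>count_space UNIV) =
        (\<Sum>\<nu> | \<mu> \<nearrow> \<nu>. ennreal (plancherel_transition \<mu> \<nu>))"
      by (intro nn_integral_count_space' finite_adds_box) (auto simp: plancherel_transition_def)
    then show ?thesis by (simp add: nonneg sum_1)
  qed
  then have "pmf (embed_pmf (plancherel_transition \<mu>)) = plancherel_transition \<mu>" for \<mu>
    by (intro ext pmf_embed_pmf nonneg)
  then show ?thesis
    using markov_chain_exists[of empty_young "\<lambda>\<mu>. embed_pmf (plancherel_transition \<mu>)"]
    by (simp add: plancherel_growth_process_iff_markov_chain_law)
qed

lemma plancherel_growth_process_iff_marginals:
  "plancherel_growth_process M \<longleftrightarrow>
    (\<exists>\<phi>. harmonic_young \<phi> \<and> chain_of \<phi> M) \<and>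
    (\<forall>n. \<forall>\<mu>\<in>young_level n.
      \<P>(\<omega> in M. \<omega> n = \<mu>) = (real (num_paths empty_young \<mu>))\<^sup>2 / fact n)"
proof (intro iffI conjI allI ballI)
  fix n \<mu> assume "plancherel_growth_process M" "\<mu> \<in> young_level n"
  then show "\<P>(\<omega> in M. \<omega> n = \<mu>) = (real (num_paths empty_young \<mu>))\<^sup>2 / fact n"
    using chain_of_marginal[where \<phi> = plancherel_function and M = M and \<mu> = \<mu> and n = n]
    by (simp add: plancherel_growth_process_def plancherel_function_def young_level_def power2_eq_square)
next
  assume "(\<exists>\<phi>. harmonic_young \<phi> \<and> chain_of \<phi> M) \<and>
    (\<forall>n. \<forall>\<mu>\<in>young_level n.
      \<P>(\<omega> in M. \<omega> n = \<mu>) = (real (num_paths empty_young \<mu>))\<^sup>2 / fact n)"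
  then obtain \<phi> where \<phi>: "harmonic_young \<phi>" "chain_of \<phi> M"
    and marginal: "\<And>n \<mu>. \<mu> \<in> young_level n \<Longrightarrow>
      \<P>(\<omega> in M. \<omega> n = \<mu>) = (real (num_paths empty_young \<mu>))\<^sup>2 / fact n"
    by blast
  have "\<phi> \<mu> = plancherel_function \<mu>" for \<mu>
  proof -
    have level: "\<mu> \<in> young_level (card (boxes \<mu>))"
      by (simp add: young_level_def)
    \<comment> \<open>The marginals recover \<open>\<phi>\<close>, because the number of paths from
      the empty diagram is positive and can be cancelled.\<close>
    have "real (num_paths empty_young \<mu>) * \<phi> \<mu> = real (num_paths empty_young \<mu>) * plancherel_function \<mu>"
      using chain_of_marginal[OF \<phi> level] marginal[OF level]
      by (simp add: plancherel_function_def power2_eq_square)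
    then show ?thesis
      using num_paths_from_empty_young_pos[of \<mu>] by simp
  qed
  then have "\<phi> = plancherel_function"
    by (rule ext)
  with \<phi> show "plancherel_growth_process M"
    by (simp add: plancherel_growth_process_def)
qed (auto simp: plancherel_growth_process_def)

theorem proposition2p5:
  shows "(\<exists>!M. merw M) \<and>
    (\<forall>M. merw M \<longleftrightarrow> plancherel_growth_process M) \<and>
    (\<forall>\<phi>. merw_function \<phi> \<longleftrightarrow> \<phi> = plancherel_function) \<and>
    (\<forall>M. plancherel_growth_process M \<longleftrightarrow>
       (\<exists>\<phi>. harmonic_young \<phi> \<and> chain_of \<phi> M) \<and>
       (\<forall>n. \<forall>\<mu>\<in>young_level n.
          \<P>(\<omega> in M. \<omega> n = \<mu>) = (real (num_paths empty_young \<mu>))\<^sup>2 / fact n)) \<and>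
    (\<forall>M. plancherel_growth_process M \<longleftrightarrow>
       markov_chain_law UNIV empty_young plancherel_transition M)"
proof (intro conjI allI)
  have merw_iff: "merw M \<longleftrightarrow> plancherel_growth_process M" for M
    by (simp add: merw_def merw_function_iff plancherel_growth_process_iff_chain_of)
  then show "merw M \<longleftrightarrow> plancherel_growth_process M" for M .
  show "\<exists>!M. merw M"
    unfolding merw_iff
    using plancherel_growth_process_exists plancherel_growth_process_unique by blast
qed (rule merw_function_iff plancherel_growth_process_iff_marginals
    plancherel_growth_process_iff_markov_chain_law)+

end
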